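(* Let $\{\lambda^{(n)}\vdash n\}$, $\{\mu^{(n)}\vdash n\}$, $\{\nu^{(n)}\vdash n\}$ be three partition sequences such that $$g\bigl(\lambda^{(n)},\mu^{(n)},\nu^{(n)}\bigr) \,=\, \sqrt{n!}\; e^{-O(\sqrt{n})}. \qquad (\dagger)$$ Then all three partition sequences are Plancherel. Conversely, for every two Plancherel partition sequences $\{\lambda^{(n)}\vdash n\}$ and $\{\mu^{(n)}\vdash n\}$, there exists a Plancherel partition sequence $\{\nu^{(n)}\vdash n\}$ such that $(\dagger)$ holds.
   Context: For $\lambda\vdash n$, $\chi^\lambda$ denotes the irreducible character of $S_n$ indexed by $\lambda$ and $f^\lambda=\chi^\lambda(1)$ its dimension (the number of standard Young tableaux of shape $\lambda$). The Kronecker coefficients $g(\lambda,\mu,\nu)$, for $\lambda,\mu,\nu\vdash n$, are defined by $\chi^\mu\cdot\chi^\nu=\sum_{\lambda\vdash n} g(\lambda,\mu,\nu)\,\chi^\lambda$. A sequence of partitions $\{\lambda^{(n)}\vdash n\}$ is called Plancherel if for some $a>0$ we have $f^{\lambda^{(n)}}\ge \sqrt{n!}\,e^{-a\sqrt{n}}$ for all $n$. The notation $X(n)=Y(n)\,e^{-O(h(n))}$ means that there is a constant $C>0$ with $Y(n)e^{-Ch(n)}\le X(n)\le Y(n)e^{Ch(n)}$ for all sufficiently large $n$. *)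

theory Defs
  imports Complex_Main "HOL-Library.Function_Algebras" "HOL-Combinatorics.Permutations"
begin

section \<open>Complex function spaces and traces\<close>

definition cscale :: "complex \<Rightarrow> ('a \<Rightarrow> complex) \<Rightarrow> ('a \<Rightarrow> complex)" where
  "cscale c f = (\<lambda>x. c * f x)"

global_interpretation cfun: vector_space "cscale :: complex \<Rightarrow> ('a \<Rightarrow> complex) \<Rightarrow> ('a \<Rightarrow> complex)"
  by standard (auto simp: cscale_def fun_eq_iff algebra_simps)

text \<open>
  The trace of \<open>A\<close> on a finite-dimensional \<open>A\<close>-invariant subspace \<open>V\<close>: the sum of the diagonal
  entries of the matrix of \<open>A\<close> in some basis of \<open>V\<close>.
\<close>

definition trace_on :: "('a \<Rightarrow> complex) set \<Rightarrow> (('a \<Rightarrow> complex) \<Rightarrow> ('a \<Rightarrow> complex)) \<Rightarrow> complex" where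
  "trace_on V A =
     (let B = (SOME B. cfun.independent B \<and> cfun.span B = V)
      in \<Sum>b\<in>B. cfun.representation B (A b) b)"


section \<open>Specht modules and the irreducible characters of the symmetric group\<close>

definition partitions :: "nat \<Rightarrow> nat list set" where
  "partitions n = {la. sorted_wrt (\<ge>) la \<and> 0 \<notin> set la \<and> sum_list la = n}"

text \<open>The symmetric group on \<open>n\<close> letters acts on \<open>{..<n}\<close>.\<close>

definition sym_grp :: "nat \<Rightarrow> (nat \<Rightarrow> nat) set" where
  "sym_grp n = {\<sigma>. \<sigma> permutes {..<n}}"

definition cells :: "nat list \<Rightarrow> (nat \<times> nat) set" where
  "cells la = {(i, j). i < length la \<and> j < la ! i}"

text \<open>
  A Young tableau is represented by the map sending each entry to its (row, column) position.
  Thus \<open>\<sigma>\<close> acts on tableaux by \<open>T \<mapsto> T \<circ> inv \<sigma>\<close>.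
\<close>

definition tableaux :: "nat list \<Rightarrow> (nat \<Rightarrow> nat \<times> nat) set" where
  "tableaux la = {T. bij_betw T {..<sum_list la} (cells la)}"

text \<open>
  A tabloid (a row-equivalence class of tableaux) is represented by the map sending each entry
  to its row, with value \<open>0\<close> outside the set of entries.
\<close>

definition tabloid :: "nat \<Rightarrow> (nat \<Rightarrow> nat \<times> nat) \<Rightarrow> (nat \<Rightarrow> nat)" where
  "tabloid n T = (\<lambda>i. if i < n then fst (T i) else 0)"

definition column_stabilizer :: "nat \<Rightarrow> (nat \<Rightarrow> nat \<times> nat) \<Rightarrow> (nat \<Rightarrow> nat) set" where
  "column_stabilizer n T = {\<pi> \<in> sym_grp n. \<forall>i<n. snd (T (\<pi> i)) = snd (T i)}"

text \<open>
  Elements of the permutation module on tabloids are functions from tabloids to \<open>\<complex>\<close>; the tabloid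
  \<open>t\<close> itself corresponds to the indicator function of \<open>{t}\<close>.
\<close>

definition polytabloid :: "nat \<Rightarrow> (nat \<Rightarrow> nat \<times> nat) \<Rightarrow> ((nat \<Rightarrow> nat) \<Rightarrow> complex)" where
  "polytabloid n T =
     (\<lambda>t. \<Sum>\<pi>\<in>column_stabilizer n T.
        of_int (sign \<pi>) * (if t = tabloid n (T \<circ> inv \<pi>) then 1 else 0))"

definition specht :: "nat list \<Rightarrow> ((nat \<Rightarrow> nat) \<Rightarrow> complex) set" where
  "specht la = cfun.span (polytabloid (sum_list la) ` tableaux la)"

text \<open>
  On tabloids \<open>\<sigma>\<close> acts by \<open>t \<mapsto> t \<circ> inv \<sigma>\<close>, hence on functions of tabloids by
  \<open>f \<mapsto> (\<lambda>t. f (t \<circ> \<sigma>))\<close>.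
\<close>

definition perm_act :: "(nat \<Rightarrow> nat) \<Rightarrow> ((nat \<Rightarrow> nat) \<Rightarrow> complex) \<Rightarrow> ((nat \<Rightarrow> nat) \<Rightarrow> complex)" where
  "perm_act \<sigma> f = (\<lambda>t. f (t \<circ> \<sigma>))"

definition irr_char :: "nat list \<Rightarrow> (nat \<Rightarrow> nat) \<Rightarrow> complex" where
  "irr_char la \<sigma> = trace_on (specht la) (perm_act \<sigma>)"

definition char_dim :: "nat list \<Rightarrow> nat" where
  "char_dim la = cfun.dim (specht la)"

lemma perm_act_polytabloid:
  assumes s: "\<sigma> \<in> sym_grp n"
  shows "perm_act \<sigma> (polytabloid n T) = polytabloid n (T \<circ> inv \<sigma>)"
proof
  fix t :: "nat \<Rightarrow> nat"
  have ps: "\<sigma> permutes {..<n}" using s by (simp add: sym_grp_def)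
  have bs: "bij \<sigma>" using ps by (rule permutes_bij)
  have pis: "inv \<sigma> permutes {..<n}" using ps by (rule permutes_inv)
  have c1: "\<sigma> \<circ> inv \<sigma> = id" "inv \<sigma> \<circ> \<sigma> = id"
    using permutes_inv_o[OF ps] by auto
  have c1x: "\<sigma> (inv \<sigma> x) = x" "inv \<sigma> (\<sigma> x) = x" for x
    using permutes_inverses[OF ps] by auto
  have lt: "\<sigma> i < n \<longleftrightarrow> i < n" "inv \<sigma> i < n \<longleftrightarrow> i < n" for i
    using permutes_in_image[OF ps] permutes_in_image[OF pis] by auto
  have tab: "tabloid n (S \<circ> inv \<sigma>) = tabloid n S \<circ> inv \<sigma>" for S
    by (auto simp: tabloid_def fun_eq_iff lt)
  have eq: "t \<circ> \<sigma> = u \<longleftrightarrow> t = u \<circ> inv \<sigma>" for u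
    by (metis c1 comp_assoc comp_id)
  have "perm_act \<sigma> (polytabloid n T) t =
     (\<Sum>\<pi>\<in>column_stabilizer n T.
        of_int (sign \<pi>) * (if t \<circ> \<sigma> = tabloid n (T \<circ> inv \<pi>) then 1 else 0))"
    by (simp add: perm_act_def polytabloid_def)
  also have "\<dots> = (\<Sum>\<pi>\<in>column_stabilizer n (T \<circ> inv \<sigma>).
        of_int (sign \<pi>) * (if t = tabloid n (T \<circ> inv \<sigma> \<circ> inv \<pi>) then 1 else 0))"
  proof (rule sum.reindex_bij_witness[where i = "\<lambda>\<pi>. inv \<sigma> \<circ> \<pi> \<circ> \<sigma>" and j = "\<lambda>\<pi>. \<sigma> \<circ> \<pi> \<circ> inv \<sigma>"])
    fix \<pi> assume p: "\<pi> \<in> column_stabilizer n T"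
    hence pp: "\<pi> permutes {..<n}" by (simp add: column_stabilizer_def sym_grp_def)
    show "inv \<sigma> \<circ> (\<sigma> \<circ> \<pi> \<circ> inv \<sigma>) \<circ> \<sigma> = \<pi>"
      by (simp add: fun_eq_iff c1x)
    show "\<sigma> \<circ> \<pi> \<circ> inv \<sigma> \<in> column_stabilizer n (T \<circ> inv \<sigma>)"
      using p by (auto simp: column_stabilizer_def sym_grp_def c1x lt intro!: permutes_compose pis ps)
    have sg: "sign (\<sigma> \<circ> \<pi> \<circ> inv \<sigma>) = sign \<pi>"
    proof -
      have "permutation \<sigma>" "permutation \<pi>" "permutation (inv \<sigma>)"
        using ps pp pis by (auto simp: permutation_permutes)
      thus ?thesis
        by (simp add: sign_compose permutation_compose sign_inverse sign_idempotent)
    qed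
    have bp: "bij \<pi>" using pp by (rule permutes_bij)
    have iv: "inv (\<sigma> \<circ> \<pi> \<circ> inv \<sigma>) = \<sigma> \<circ> inv \<pi> \<circ> inv \<sigma>"
      using bs bp by (simp add: o_inv_distrib bij_comp bij_imp_bij_inv inv_inv_eq comp_assoc)
    have "T \<circ> inv \<sigma> \<circ> inv (\<sigma> \<circ> \<pi> \<circ> inv \<sigma>) = (T \<circ> inv \<pi>) \<circ> inv \<sigma>"
      unfolding iv by (simp add: fun_eq_iff c1x)
    thus "of_int (sign (\<sigma> \<circ> \<pi> \<circ> inv \<sigma>)) *
        (if t = tabloid n (T \<circ> inv \<sigma> \<circ> inv (\<sigma> \<circ> \<pi> \<circ> inv \<sigma>)) then 1 else 0) =
        of_int (sign \<pi>) * (if t \<circ> \<sigma> = tabloid n (T \<circ> inv \<pi>) then 1 else (0::complex))"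
      by (simp add: sg tab eq)
  next
    fix \<pi> assume p: "\<pi> \<in> column_stabilizer n (T \<circ> inv \<sigma>)"
    show "\<sigma> \<circ> (inv \<sigma> \<circ> \<pi> \<circ> \<sigma>) \<circ> inv \<sigma> = \<pi>"
      by (simp add: fun_eq_iff c1x)
    have "snd (T (inv \<sigma> (\<pi> (\<sigma> i)))) = snd (T i)" if "i < n" for i
      using p that lt(1)[of i] by (auto simp: column_stabilizer_def c1x)
    thus "inv \<sigma> \<circ> \<pi> \<circ> \<sigma> \<in> column_stabilizer n T"
      using p by (auto simp: column_stabilizer_def sym_grp_def intro!: permutes_compose pis ps)
  qed
  also have "\<dots> = polytabloid n (T \<circ> inv \<sigma>) t"
    by (simp add: polytabloid_def)
  finally show "perm_act \<sigma> (polytabloid n T) t = polytabloid n (T \<circ> inv \<sigma>) t" .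
qed

lemma perm_act_specht:
  assumes "\<sigma> \<in> sym_grp (sum_list la)" and "f \<in> specht la"
  shows "perm_act \<sigma> f \<in> specht la"
proof -
  let ?n = "sum_list la"
  have ps: "\<sigma> permutes {..<?n}" using assms by (simp add: sym_grp_def)
  have bij: "T \<circ> inv \<sigma> \<in> tableaux la" if "T \<in> tableaux la" for T
    using that permutes_imp_bij[OF permutes_inv[OF ps]]
    by (auto simp: tableaux_def intro: bij_betw_trans)
  from assms(2) show ?thesis
    unfolding specht_def
  proof (induction rule: cfun.span_induct_alt)
    case base
    have "perm_act \<sigma> 0 = 0" by (simp add: perm_act_def fun_eq_iff)
    thus ?case by (metis cfun.span_zero)
  next
    case (step c x y)
    then obtain T where T: "T \<in> tableaux la" "x = polytabloid ?n T" by auto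
    have "perm_act \<sigma> (cscale c x + y) = cscale c (perm_act \<sigma> x) + perm_act \<sigma> y"
      by (simp add: perm_act_def cscale_def fun_eq_iff)
    moreover have "perm_act \<sigma> x \<in> polytabloid ?n ` tableaux la"
      using T bij perm_act_polytabloid[OF assms(1)] by auto
    ultimately show ?case
      using step.IH by (metis cfun.span_add cfun.span_scale cfun.span_base)
  qed
qed

lemma irr_char_id: "irr_char la id = of_nat (char_dim la)"
proof -
  define B where "B = (SOME B. cfun.independent B \<and> cfun.span B = specht la)"
  obtain B0 where "cfun.independent B0" "cfun.span B0 = cfun.span (specht la)"
    by (metis cfun.basis_exists cfun.span_subspace cfun.span_eq cfun.span_mono cfun.span_span subset_antisym)
  hence "cfun.independent B0 \<and> cfun.span B0 = specht la"
    by (simp add: specht_def)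
  hence B: "cfun.independent B" "cfun.span B = specht la"
    unfolding B_def by (metis (mono_tags, lifting) someI)+
  have "irr_char la id = (\<Sum>b\<in>B. cfun.representation B b b)"
    by (simp add: irr_char_def trace_on_def B_def[symmetric] perm_act_def Let_def)
  also have "\<dots> = of_nat (card B)"
    using B(1) by (simp add: cfun.representation_basis)
  also have "card B = char_dim la"
    unfolding char_dim_def by (metis B cfun.dim_eq_card cfun.span_span)
  finally show ?thesis .
qed


section \<open>Kronecker coefficients\<close>

text \<open>
  The coefficient of \<open>irr_char la\<close> in the expansion of \<open>irr_char mu * irr_char nu\<close>; the expansion
  is unique because the irreducible characters are linearly independent. The support condition
  only makes the coefficient function unique as a function on all lists.
\<close>

definition kronecker :: "nat list \<Rightarrow> nat list \<Rightarrow> nat list \<Rightarrow> real" where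
  "kronecker la mu nu =
     (let n = sum_list la in
      THE g. (\<forall>ka. ka \<notin> partitions n \<longrightarrow> g ka = 0) \<and>
             (\<forall>\<sigma>\<in>sym_grp n. irr_char mu \<sigma> * irr_char nu \<sigma>
                = (\<Sum>ka\<in>partitions n. of_real (g ka) * irr_char ka \<sigma>))) la"


section \<open>Partition sequences\<close>

definition partition_seq :: "(nat \<Rightarrow> nat list) \<Rightarrow> bool" where
  "partition_seq la \<longleftrightarrow> (\<forall>n. la n \<in> partitions n)"

definition plancherel :: "(nat \<Rightarrow> nat list) \<Rightarrow> bool" where
  "plancherel la \<longleftrightarrow> partition_seq la \<and>
     (\<exists>a>0. \<forall>n. real (char_dim (la n)) \<ge> sqrt (fact n) * exp (- a * sqrt (real n)))"

text \<open>This renders $X(n) = Y(n)\,e^{-O(h(n))}$.\<close>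

definition eq_exp_O :: "(nat \<Rightarrow> real) \<Rightarrow> (nat \<Rightarrow> real) \<Rightarrow> (nat \<Rightarrow> real) \<Rightarrow> bool" where
  "eq_exp_O X Y h \<longleftrightarrow>
     (\<exists>C>0. \<forall>\<^sub>F n in sequentially. Y n * exp (- C * h n) \<le> X n \<and> X n \<le> Y n * exp (C * h n))"

definition kronecker_asymp :: "(nat \<Rightarrow> nat list) \<Rightarrow> (nat \<Rightarrow> nat list) \<Rightarrow> (nat \<Rightarrow> nat list) \<Rightarrow> bool" where
  "kronecker_asymp la mu nu \<longleftrightarrow>
     eq_exp_O (\<lambda>n. kronecker (la n) (mu n) (nu n)) (\<lambda>n. sqrt (fact n)) (\<lambda>n. sqrt (real n))"

end

theory Submission
  imports Defs "HOL-Combinatorics.Orbits" "HOL-Analysis.Gamma_Function"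
begin

text \<open>
  Write \<open>f\<close> for the dimension of an irreducible character and \<open>g\<close> for a Kronecker coefficient. The
  characters are real and orthonormal for the averaged product over the group, so \<open>g\<close> is the average
  of a product of three characters. It is therefore symmetric in its arguments, and since each
  character is bounded by its dimension and has norm one, \<open>g\<close> is at most each of the three dimensions
  (\<open>kronecker_le_char_dim\<close>). A lower bound of order \<open>sqrt (n!) exp (- C sqrt n)\<close> on \<open>g\<close> thus passes to
  the dimensions, which is the first half.

  Conversely, evaluating the expansion of a product at the identity shows that \<open>f\<^sup>\<lambda> f\<^sup>\<mu>\<close> is the sum of
  \<open>g(\<lambda>, \<mu>, \<nu>) f\<^sup>\<nu>\<close> over the partitions \<open>\<nu>\<close> of \<open>n\<close>. If \<open>\<lambda>\<close> and \<open>\<mu>\<close> are Plancherel, this sum is at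
  least \<open>n!\<close> up to a factor \<open>exp (O (sqrt n))\<close>; it has at most \<open>exp (O (sqrt n))\<close> terms
  (\<open>card_partitions_exp_sqrt\<close>), and every \<open>f\<^sup>\<nu>\<close> is at most \<open>sqrt (n!)\<close>. Hence some \<open>\<nu>\<close> has \<open>g\<close> of order
  \<open>sqrt (n!)\<close> up to such a factor (\<open>ex_large_kronecker\<close>), and \<open>f\<^sup>\<nu> \<ge> g\<close> makes it Plancherel.

  The character theory rests on one combinatorial fact: the signed sum over the column stabilizer of
  a tableau \<open>T\<close> maps the permutation module of its shape onto the line spanned by the polytabloid
  \<open>e\<close> of \<open>T\<close>, and kills the modules of other shapes whose row indices have no larger sum
  (\<open>column_antisym_supported\<close>). Hence an operator that commutes with the group maps \<open>e\<close> to a multiple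
  of itself, so it is a scalar on the Specht module. Applied to the averages of rank-one operators,
  this yields an explicit formula for the characters as averages of the matrix coefficients of \<open>e\<close>
  (\<open>irr_char_formula\<close>), and from it reality, boundedness and orthonormality. The characters span all
  class functions by a count of dimensions: every permutation is, after relabelling by a tableau of
  some shape, the cyclic shift of the rows of that shape, so there are at most as many conjugacy
  classes as partitions (\<open>class_function_expansion\<close>).
\<close>

section \<open>Tableaux and straightening\<close>

text \<open>
  The statistic \<open>n(\<lambda>) = 0 \<lambda>\<^sub>0 + 1 \<lambda>\<^sub>1 + 2 \<lambda>\<^sub>2 + \<dots>\<close>. It strictly decreases along the
  dominance order, and comparing its values takes the place of comparing shapes.
\<close>

definition row_weight :: "nat list \<Rightarrow> nat" where
  "row_weight la = (\<Sum>c\<in>cells la. fst c)"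

lemma cells_Sigma: "cells la = (SIGMA i:{..<length la}. {..<la ! i})"
  by (auto simp: cells_def)

lemma finite_cells [simp]: "finite (cells la)"
  by (simp add: cells_Sigma)

lemma card_cells: "card (cells la) = sum_list la"
  by (simp add: cells_Sigma sum_list_sum_nth atLeast0LessThan)

lemma length_le_sum_list: "0 \<notin> set la \<Longrightarrow> length la \<le> sum_list (la :: nat list)"
  by (induction la) auto

lemma sum_list_partition: "la \<in> partitions n \<Longrightarrow> sum_list la = n"
  by (simp add: partitions_def)

lemma length_partition_le: "la \<in> partitions n \<Longrightarrow> length la \<le> n"
  using length_le_sum_list by (auto simp: partitions_def)

lemma finite_partitions [simp]: "finite (partitions n)"
proof (rule finite_subset)
  show "partitions n \<subseteq> {xs. set xs \<subseteq> {..n} \<and> length xs \<le> n}"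
    using length_partition_le member_le_sum_list by (fastforce simp: partitions_def)
  show "finite {xs. set xs \<subseteq> {..n} \<and> length xs \<le> n}"
    by (rule finite_lists_length_le) simp
qed

lemma tableaux_bij: "T \<in> tableaux la \<Longrightarrow> la \<in> partitions n \<Longrightarrow> bij_betw T {..<n} (cells la)"
  by (simp add: tableaux_def sum_list_partition)

lemma ex_tableau: "\<exists>T. T \<in> tableaux la"
  using finite_same_card_bij[of "{..<sum_list la}" "cells la"] card_cells[of la]
  by (auto simp: tableaux_def)

lemma cells_column_down:
  assumes "la \<in> partitions n" "(i, j) \<in> cells la" "i' \<le> i"
  shows "(i', j) \<in> cells la"
proof -
  have "la ! i \<le> la ! i'" if "i' < i"
    using assms that sorted_wrt_nth_less[of "(\<ge>)" la i' i] by (auto simp: partitions_def cells_def)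
  thus ?thesis
    using assms by (cases "i' = i") (auto simp: cells_def)
qed

lemma card_row:
  assumes "la \<in> partitions n" "T \<in> tableaux la"
  shows "card {x. x < n \<and> fst (T x) = i} = (if i < length la then la ! i else 0)"
proof -
  have b: "bij_betw T {..<n} (cells la)" using assms tableaux_bij by blast
  have "bij_betw T {x. x < n \<and> fst (T x) = i} {c \<in> cells la. fst c = i}"
    using b unfolding bij_betw_def
    by (intro conjI) (auto intro: inj_on_subset simp flip: bij_betw_imp_surj_on[OF b])
  hence "card {x. x < n \<and> fst (T x) = i} = card {c \<in> cells la. fst c = i}"
    by (rule bij_betw_same_card)
  also have "{c \<in> cells la. fst c = i} = (if i < length la then {i} \<times> {..<la ! i} else {})"
    by (auto simp: cells_def)
  finally show ?thesis by (simp add: card_cartesian_product)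
qed

lemma partition_eqI:
  assumes "la \<in> partitions n" "mu \<in> partitions m"
    and "\<And>i. (if i < length la then la ! i else 0) = (if i < length mu then mu ! i else 0)"
  shows "la = mu"
proof (rule nth_equalityI)
  have pos: "i < length ka \<Longrightarrow> ka ! i \<noteq> 0" if "ka \<in> partitions k" for i k ka
    using that nth_mem[of i ka] unfolding partitions_def by (metis (mono_tags, lifting) mem_Collect_eq)
  have "\<not> length la < length mu" "\<not> length mu < length la"
    using assms(3)[of "length la"] assms(3)[of "length mu"] pos[OF assms(1), of "length mu"] pos[OF assms(2), of "length la"]
    by (auto split: if_splits)
  thus l: "length la = length mu" by simp
  show "la ! i = mu ! i" if "i < length la" for i
    using assms(3)[of i] that l by simp
qed

lemma partition_eq_of_tabloid_eq:
  assumes "la \<in> partitions n" "T \<in> tableaux la" "mu \<in> partitions n" "S \<in> tableaux mu"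
    and "tabloid n T = tabloid n S"
  shows "la = mu"
proof (rule partition_eqI[OF assms(1,3)])
  fix i
  have "fst (T x) = fst (S x)" if "x < n" for x
    using fun_cong[OF assms(5), of x] that by (simp add: tabloid_def)
  hence "{x. x < n \<and> fst (T x) = i} = {x. x < n \<and> fst (S x) = i}" by auto
  thus "(if i < length la then la ! i else 0) = (if i < length mu then mu ! i else 0)"
    using card_row[OF assms(1,2), of i] card_row[OF assms(3,4), of i] by simp
qed

lemma sum_rows_tableau:
  assumes "la \<in> partitions n" "T \<in> tableaux la"
  shows "(\<Sum>x<n. fst (T x)) = row_weight la"
  unfolding row_weight_def by (rule sum.reindex_bij_betw[OF tableaux_bij[OF assms(2,1)]])

lemma tableaux_comp_permutes:
  assumes "T \<in> tableaux la" "la \<in> partitions n" "p permutes {..<n}"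
  shows "T \<circ> p \<in> tableaux la"
  using assms permutes_imp_bij[OF assms(3)]
  by (auto simp: tableaux_def sum_list_partition intro: bij_betw_trans)

lemma tableaux_transitive:
  assumes "la \<in> partitions n" "T \<in> tableaux la" "T' \<in> tableaux la"
  shows "\<exists>q. q permutes {..<n} \<and> (\<forall>x<n. T (q x) = T' x)"
proof -
  have b: "bij_betw T {..<n} (cells la)" "bij_betw T' {..<n} (cells la)"
    using assms tableaux_bij by blast+
  define q where "q x = (if x < n then inv_into {..<n} T (T' x) else x)" for x
  have "bij_betw (inv_into {..<n} T \<circ> T') {..<n} {..<n}"
    using b bij_betw_inv_into bij_betw_trans by blast
  hence "bij_betw q {..<n} {..<n}"
    by (rule bij_betw_cong[THEN iffD1, rotated]) (simp add: q_def)
  hence "q permutes {..<n}"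
    by (rule bij_imp_permutes) (simp add: q_def)
  moreover have "T (q x) = T' x" if "x < n" for x
    using that b by (simp add: q_def bij_betw_inv_into_right bij_betw_apply)
  ultimately show ?thesis by blast
qed

text \<open>
  The cells of a column form an initial segment of rows, so their number determines which rows they
  occupy.
\<close>

lemma column_length:
  assumes "la \<in> partitions n" "T \<in> tableaux la"
    and "m < card {y. y < n \<and> snd (T y) = j}"
  shows "(m, j) \<in> cells la"
proof (rule ccontr)
  assume m: "(m, j) \<notin> cells la"
  have b: "bij_betw T {..<n} (cells la)" using assms tableaux_bij by blast
  have "card {y. y < n \<and> snd (T y) = j} \<le> card {..<m}"
  proof (rule card_inj_on_le[of "\<lambda>y. fst (T y)"])
    show "inj_on (\<lambda>y. fst (T y)) {y. y < n \<and> snd (T y) = j}"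
      using b by (auto simp: bij_betw_def inj_on_def prod_eq_iff)
    show "(\<lambda>y. fst (T y)) ` {y. y < n \<and> snd (T y) = j} \<subseteq> {..<m}"
    proof clarsimp
      fix y assume "y < n" "j = snd (T y)"
      hence "(fst (T y), j) \<in> cells la" using b by (auto simp: bij_betw_def)
      thus "fst (T y) < m"
        using cells_column_down[OF assms(1), of "fst (T y)" j m] m by force
    qed
  qed simp
  thus False using assms(3) by simp
qed

text \<open>
  Sort every column of \<open>T\<close> by the values of \<open>r\<close>. An entry then lands in the row that counts the
  entries of its column with smaller value, and distinct values in a column leave room for at most
  \<open>r x\<close> of those.
\<close>

lemma straighten_columns:
  fixes r :: "nat \<Rightarrow> nat"
  assumes la: "la \<in> partitions n" and T: "T \<in> tableaux la"
    and r: "\<And>x y. x < n \<Longrightarrow> y < n \<Longrightarrow> snd (T x) = snd (T y) \<Longrightarrow> r x = r y \<Longrightarrow> x = y"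
  shows "\<exists>\<pi>\<in>column_stabilizer n T. \<forall>x<n. fst (T (inv \<pi> x)) \<le> r x"
proof -
  define L where "L x = {y. y < n \<and> snd (T y) = snd (T x) \<and> r y < r x}" for x
  define T' where "T' x = (card (L x), snd (T x))" for x
  have b: "bij_betw T {..<n} (cells la)" using la T tableaux_bij by blast
  have finL: "finite (L x)" for x by (auto simp: L_def)
  have mono: "card (L x) < card (L y)"
    if "x < n" "y < n" "snd (T x) = snd (T y)" "r x < r y" for x y
    by (rule psubset_card_mono) (use that in \<open>auto simp: L_def\<close>)
  have inj: "inj_on T' {..<n}"
  proof (rule inj_onI)
    fix x y assume xy: "x \<in> {..<n}" "y \<in> {..<n}" "T' x = T' y"
    hence "\<not> r x < r y" "\<not> r y < r x"
      using mono[of x y] mono[of y x] by (auto simp: T'_def)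
    thus "x = y" using r[of x y] xy by (auto simp: T'_def)
  qed
  have "T' x \<in> cells la" if "x < n" for x
  proof -
    have "card (L x) < card {y. y < n \<and> snd (T y) = snd (T x)}"
      by (rule psubset_card_mono) (use that in \<open>auto simp: L_def\<close>)
    thus ?thesis using column_length[OF la T] by (simp add: T'_def)
  qed
  hence "T' ` {..<n} \<subseteq> cells la" by auto
  moreover have "card (T' ` {..<n}) = card (cells la)"
    using inj la by (simp add: card_image card_cells sum_list_partition)
  ultimately have b': "bij_betw T' {..<n} (cells la)"
    using inj by (simp add: bij_betw_def card_subset_eq)
  hence "T' \<in> tableaux la" using la by (simp add: tableaux_def sum_list_partition)
  then obtain q where q: "q permutes {..<n}" and Tq: "\<And>x. x < n \<Longrightarrow> T (q x) = T' x"
    using tableaux_transitive[OF la T] by blast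
  have ip: "inv q permutes {..<n}" using q by (rule permutes_inv)
  have inv_inv: "inv (inv q) = q" using q by (simp add: permutes_inv_inv)
  have "snd (T (inv q i)) = snd (T i)" if "i < n" for i
  proof -
    have "inv q i < n" using that permutes_in_image[OF ip, of i] by simp
    from Tq[OF this] show ?thesis
      by (simp add: permutes_inverses(1)[OF q] T'_def)
  qed
  hence "inv q \<in> column_stabilizer n T"
    using ip by (simp add: column_stabilizer_def sym_grp_def)
  moreover have "fst (T (q x)) \<le> r x" if "x < n" for x
  proof -
    have "card (L x) \<le> card {..<r x}"
      by (rule card_inj_on_le[of r]) (auto simp: L_def inj_on_def intro: r)
    thus ?thesis using Tq[OF that] by (simp add: T'_def)
  qed
  ultimately show ?thesis using inv_inv by metis
qed

text \<open>
  Straightening the columns of \<open>T\<close> by the rows of \<open>S\<close> can only lower row indices. Their sums over all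
  entries are the row weights of the two shapes, so the assumption on the weights leaves no room for
  a strict decrease: every entry lies in the same row of both tableaux.
\<close>

lemma straighten_tabloid:
  assumes la: "la \<in> partitions n" and T: "T \<in> tableaux la"
    and mu: "mu \<in> partitions n" and S: "S \<in> tableaux mu"
    and w: "row_weight mu \<le> row_weight la"
    and r: "\<And>x y. x < n \<Longrightarrow> y < n \<Longrightarrow> snd (T x) = snd (T y) \<Longrightarrow> fst (S x) = fst (S y) \<Longrightarrow> x = y"
  shows "la = mu \<and> (\<exists>\<pi>\<in>column_stabilizer n T. tabloid n (T \<circ> inv \<pi>) = tabloid n S)"
proof -
  obtain \<pi> where p: "\<pi> \<in> column_stabilizer n T" and le: "\<forall>x<n. fst (T (inv \<pi> x)) \<le> fst (S x)"
    using straighten_columns[OF la T, of "\<lambda>x. fst (S x)"] r by blast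
  have T': "T \<circ> inv \<pi> \<in> tableaux la"
    using p tableaux_comp_permutes[OF T la] permutes_inv
    by (auto simp: column_stabilizer_def sym_grp_def)
  have "fst ((T \<circ> inv \<pi>) x) = fst (S x)" if "x < n" for x
  proof (rule ccontr)
    assume "fst ((T \<circ> inv \<pi>) x) \<noteq> fst (S x)"
    hence "fst ((T \<circ> inv \<pi>) x) < fst (S x)" using le[rule_format, OF that] by simp
    hence "(\<Sum>x<n. fst ((T \<circ> inv \<pi>) x)) < (\<Sum>x<n. fst (S x))"
      by (intro sum_strict_mono_ex1) (use le that in auto)
    thus False
      using w by (simp only: sum_rows_tableau[OF la T'] sum_rows_tableau[OF mu S])
  qed
  hence eq: "tabloid n (T \<circ> inv \<pi>) = tabloid n S" by (simp add: tabloid_def fun_eq_iff)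
  thus ?thesis using p partition_eq_of_tabloid_eq[OF la T' mu S eq] by blast
qed

section \<open>Column antisymmetrizers\<close>

text \<open>
  A finite set that contains the tabloids of all shapes of size \<open>n\<close> (a shape has at most \<open>n\<close> rows), so
  that one bilinear form serves for all of them.
\<close>

definition tabloid_space :: "nat \<Rightarrow> (nat \<Rightarrow> nat) set" where
  "tabloid_space n = {t. \<forall>i. (i \<in> {..<n} \<longrightarrow> t i \<in> {..<n}) \<and> (i \<notin> {..<n} \<longrightarrow> t i = 0)}"

text \<open>
  The form is bilinear and not hermitian; polytabloids are real-valued, and on real-valued functions
  it is the standard inner product.
\<close>

definition form :: "nat \<Rightarrow> ((nat \<Rightarrow> nat) \<Rightarrow> complex) \<Rightarrow> ((nat \<Rightarrow> nat) \<Rightarrow> complex) \<Rightarrow> complex" where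
  "form n f g = (\<Sum>t\<in>tabloid_space n. f t * g t)"

definition indic :: "'a \<Rightarrow> 'a \<Rightarrow> complex" where
  "indic a = (\<lambda>b. if b = a then 1 else 0)"

text \<open>
  The action of the signed sum \<open>\<kappa>\<^sub>T\<close> of the column stabilizer of \<open>T\<close>.
\<close>

definition column_antisym :: "nat \<Rightarrow> (nat \<Rightarrow> nat \<times> nat) \<Rightarrow> ((nat \<Rightarrow> nat) \<Rightarrow> complex) \<Rightarrow> ((nat \<Rightarrow> nat) \<Rightarrow> complex)" where
  "column_antisym n T f = (\<lambda>t. \<Sum>\<pi>\<in>column_stabilizer n T. of_int (sign \<pi>) * f (t \<circ> \<pi>))"

text \<open>
  Membership in the permutation module spanned by the tabloids of a given shape.
\<close>

definition supported_on_shape :: "nat \<Rightarrow> nat list \<Rightarrow> ((nat \<Rightarrow> nat) \<Rightarrow> complex) \<Rightarrow> bool" where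
  "supported_on_shape n la f \<longleftrightarrow> (\<forall>t. f t \<noteq> 0 \<longrightarrow> t \<in> tabloid n ` tableaux la)"

lemma finite_tabloid_space [simp]: "finite (tabloid_space n)"
  unfolding tabloid_space_def by (rule finite_set_of_finite_funs) auto

lemma tabloid_in_space:
  assumes "la \<in> partitions n" "T \<in> tableaux la"
  shows "tabloid n T \<in> tabloid_space n"
proof -
  have "fst (T i) < n" if "i < n" for i
  proof -
    have "T i \<in> cells la" using that tableaux_bij[OF assms(2,1)] by (auto simp: bij_betw_def)
    thus ?thesis using length_partition_le[OF assms(1)] by (auto simp: cells_def)
  qed
  thus ?thesis by (auto simp: tabloid_space_def tabloid_def)
qed

lemma sym_grp_finite [simp]: "finite (sym_grp n)"
  unfolding sym_grp_def by (rule finite_permutations) simp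

lemma card_sym_grp: "card (sym_grp n) = fact n"
  unfolding sym_grp_def using card_permutations[of "{..<n}" n] by simp

lemma id_sym_grp [simp]: "id \<in> sym_grp n"
  by (simp add: sym_grp_def permutes_id)

lemma comp_sym_grp [intro, simp]: "\<sigma> \<in> sym_grp n \<Longrightarrow> \<tau> \<in> sym_grp n \<Longrightarrow> \<sigma> \<circ> \<tau> \<in> sym_grp n"
  by (simp add: sym_grp_def permutes_compose)

lemma inv_sym_grp [intro, simp]: "\<sigma> \<in> sym_grp n \<Longrightarrow> inv \<sigma> \<in> sym_grp n"
  by (simp add: sym_grp_def permutes_inv)

lemma inv_comp_sym_grp:
  assumes "\<sigma> \<in> sym_grp n"
  shows "\<sigma> \<circ> inv \<sigma> = id" "inv \<sigma> \<circ> \<sigma> = id" "inv (inv \<sigma>) = \<sigma>"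
  using assms permutes_inv_o[of \<sigma>] permutes_inv_inv[of \<sigma>] by (auto simp: sym_grp_def)

lemma sum_sym_grp_left:
  assumes "\<rho> \<in> sym_grp n"
  shows "(\<Sum>\<sigma>\<in>sym_grp n. h (\<rho> \<circ> \<sigma>)) = (\<Sum>\<sigma>\<in>sym_grp n. h \<sigma>)"
proof -
  have "\<rho> \<circ> (inv \<rho> \<circ> \<sigma>) = \<sigma>" "inv \<rho> \<circ> (\<rho> \<circ> \<sigma>) = \<sigma>" for \<sigma>
    by (simp_all add: inv_comp_sym_grp[OF assms] flip: comp_assoc)
  thus ?thesis
    by (intro sum.reindex_bij_witness[where i = "\<lambda>\<sigma>. inv \<rho> \<circ> \<sigma>" and j = "\<lambda>\<sigma>. \<rho> \<circ> \<sigma>"])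
       (use assms in auto)
qed

lemma perm_act_comp: "perm_act \<sigma> (perm_act \<tau> f) = perm_act (\<sigma> \<circ> \<tau>) f"
  by (simp add: perm_act_def comp_assoc)

lemma perm_act_id [simp]: "perm_act id f = f"
  by (simp add: perm_act_def)

lemma tabloid_space_comp:
  assumes "\<sigma> \<in> sym_grp n" "t \<in> tabloid_space n"
  shows "t \<circ> \<sigma> \<in> tabloid_space n"
proof -
  have "\<sigma> permutes {..<n}" using assms by (simp add: sym_grp_def)
  thus ?thesis using assms permutes_in_image[of \<sigma> "{..<n}"]
    by (auto simp: tabloid_space_def)
qed

lemma form_perm_act:
  assumes "\<sigma> \<in> sym_grp n"
  shows "form n (perm_act \<sigma> f) (perm_act \<sigma> g) = form n f g"
proof -
  have "(t \<circ> \<sigma>) \<circ> inv \<sigma> = t" "(t \<circ> inv \<sigma>) \<circ> \<sigma> = t" for t :: "nat \<Rightarrow> nat"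
    by (simp_all add: inv_comp_sym_grp[OF assms] comp_assoc)
  thus ?thesis
    unfolding form_def perm_act_def
    by (intro sum.reindex_bij_witness[where i = "\<lambda>t. t \<circ> inv \<sigma>" and j = "\<lambda>t. t \<circ> \<sigma>"])
       (use tabloid_space_comp[OF assms] tabloid_space_comp[OF inv_sym_grp[OF assms]] in auto)
qed

lemma form_perm_act_left:
  assumes "\<sigma> \<in> sym_grp n"
  shows "form n (perm_act \<sigma> f) g = form n f (perm_act (inv \<sigma>) g)"
  using form_perm_act[OF assms, of f "perm_act (inv \<sigma>) g"]
  by (simp add: perm_act_comp inv_comp_sym_grp[OF assms])

lemma form_commute: "form n f g = form n g f"
  by (simp add: form_def mult.commute)

lemma form_sum_right: "form n f (\<lambda>t. \<Sum>i\<in>I. c i * h i t) = (\<Sum>i\<in>I. c i * form n f (h i))"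
  unfolding form_def sum_distrib_left
  by (subst sum.swap) (simp add: mult_ac)

lemma form_cscale_right: "form n f (cscale c g) = c * form n f g"
  by (simp add: form_def cscale_def sum_distrib_left mult_ac)

lemma form_cscale_left: "form n (cscale c f) g = c * form n f g"
  by (simp add: form_def cscale_def sum_distrib_left mult_ac)

lemma column_stabilizer_sym_grp: "\<pi> \<in> column_stabilizer n T \<Longrightarrow> \<pi> \<in> sym_grp n"
  by (simp add: column_stabilizer_def)

lemma finite_column_stabilizer [simp]: "finite (column_stabilizer n T)"
  by (rule finite_subset[of _ "sym_grp n"]) (auto simp: column_stabilizer_def)

lemma sym_grp_less: "\<sigma> \<in> sym_grp n \<Longrightarrow> i < n \<Longrightarrow> \<sigma> i < n"
  using permutes_in_image[of \<sigma> "{..<n}" i] by (simp add: sym_grp_def)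

lemma column_stabilizer_comp:
  "\<pi> \<in> column_stabilizer n T \<Longrightarrow> \<rho> \<in> column_stabilizer n T \<Longrightarrow> \<pi> \<circ> \<rho> \<in> column_stabilizer n T"
  using sym_grp_less[of \<rho> n] by (auto simp: column_stabilizer_def)

lemma column_stabilizer_inv:
  assumes "\<pi> \<in> column_stabilizer n T"
  shows "inv \<pi> \<in> column_stabilizer n T"
proof -
  have p: "\<pi> \<in> sym_grp n" using assms by (rule column_stabilizer_sym_grp)
  have "snd (T (inv \<pi> i)) = snd (T i)" if "i < n" for i
  proof -
    have "inv \<pi> i < n" by (rule sym_grp_less[OF inv_sym_grp[OF p] that])
    hence "snd (T (\<pi> (inv \<pi> i))) = snd (T (inv \<pi> i))"
      using assms by (simp add: column_stabilizer_def)
    thus ?thesis using fun_cong[OF inv_comp_sym_grp(1)[OF p], of i] by simp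
  qed
  thus ?thesis using p by (simp add: column_stabilizer_def)
qed

lemma sign_sym_grp:
  "\<sigma> \<in> sym_grp n \<Longrightarrow> \<tau> \<in> sym_grp n \<Longrightarrow> sign (\<sigma> \<circ> \<tau>) = sign \<sigma> * sign \<tau>"
  by (rule sign_compose) (auto simp: sym_grp_def permutation_permutes)

lemma sign_cancel: "(of_int (sign \<sigma>) :: complex) * (of_int (sign \<sigma>) * z) = z"
  by (simp add: sign_def)

lemma sign_comp_cancel:
  assumes "\<sigma> \<in> sym_grp n" "\<tau> \<in> sym_grp n"
  shows "(of_int (sign \<tau>) :: complex) * (of_int (sign (\<sigma> \<circ> \<tau>)) * z) = of_int (sign \<sigma>) * z"
    and "(of_int (sign \<sigma>) :: complex) * (of_int (sign (\<sigma> \<circ> \<tau>)) * z) = of_int (sign \<tau>) * z"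
  by (simp_all add: sign_sym_grp[OF assms] mult.assoc mult.left_commute sign_cancel)

lemma column_antisym_perm_act:
  assumes r: "\<rho> \<in> column_stabilizer n T"
  shows "column_antisym n T (perm_act \<rho> f) = cscale (of_int (sign \<rho>)) (column_antisym n T f)"
proof
  fix t
  have g: "\<pi> \<in> column_stabilizer n T \<Longrightarrow> \<pi> \<in> sym_grp n" for \<pi>
    by (rule column_stabilizer_sym_grp)
  have 1: "(\<pi> \<circ> \<rho>) \<circ> inv \<rho> = \<pi>" "(\<pi> \<circ> inv \<rho>) \<circ> \<rho> = \<pi>" for \<pi> :: "nat \<Rightarrow> nat"
    by (simp_all add: inv_comp_sym_grp[OF g[OF r]] comp_assoc)
  have "column_antisym n T (perm_act \<rho> f) t
      = (\<Sum>\<pi>\<in>column_stabilizer n T. of_int (sign \<rho>) * (of_int (sign (\<pi> \<circ> \<rho>)) * f (t \<circ> (\<pi> \<circ> \<rho>))))"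
    unfolding column_antisym_def perm_act_def
    by (intro sum.cong refl) (simp add: sign_comp_cancel[OF g g[OF r]] comp_assoc)
  also have "\<dots> = of_int (sign \<rho>) * (\<Sum>\<pi>\<in>column_stabilizer n T. of_int (sign (\<pi> \<circ> \<rho>)) * f (t \<circ> (\<pi> \<circ> \<rho>)))"
    by (simp add: sum_distrib_left)
  also have "(\<Sum>\<pi>\<in>column_stabilizer n T. of_int (sign (\<pi> \<circ> \<rho>)) * f (t \<circ> (\<pi> \<circ> \<rho>)))
      = (\<Sum>\<pi>\<in>column_stabilizer n T. of_int (sign \<pi>) * f (t \<circ> \<pi>))"
    by (rule sum.reindex_bij_witness[where i = "\<lambda>\<pi>. \<pi> \<circ> inv \<rho>" and j = "\<lambda>\<pi>. \<pi> \<circ> \<rho>"])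
       (simp_all add: 1 column_stabilizer_comp r column_stabilizer_inv)
  finally show "column_antisym n T (perm_act \<rho> f) t = cscale (of_int (sign \<rho>)) (column_antisym n T f) t"
    by (simp add: cscale_def column_antisym_def)
qed

lemma perm_act_indic:
  assumes "\<sigma> \<in> sym_grp n"
  shows "perm_act \<sigma> (indic t) = indic (t \<circ> inv \<sigma>)"
proof -
  have "s \<circ> \<sigma> = t \<longleftrightarrow> s = t \<circ> inv \<sigma>" for s
    by (metis inv_comp_sym_grp(1,2)[OF assms] comp_assoc comp_id)
  thus ?thesis by (simp add: perm_act_def indic_def fun_eq_iff)
qed

lemma tabloid_comp:
  "\<sigma> \<in> sym_grp n \<Longrightarrow> tabloid n (T \<circ> \<sigma>) = tabloid n T \<circ> \<sigma>"
  using permutes_in_image[of \<sigma> "{..<n}"]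
  by (auto simp: tabloid_def fun_eq_iff sym_grp_def)

lemma polytabloid_eq_column_antisym: "polytabloid n T = column_antisym n T (indic (tabloid n T))"
proof
  fix t
  have "perm_act \<pi> (indic (tabloid n T)) t = (if t = tabloid n (T \<circ> inv \<pi>) then 1 else 0)"
    if "\<pi> \<in> column_stabilizer n T" for \<pi>
    unfolding perm_act_indic[OF column_stabilizer_sym_grp[OF that]]
      tabloid_comp[OF inv_sym_grp[OF column_stabilizer_sym_grp[OF that]]]
    by (simp add: indic_def)
  thus "polytabloid n T t = column_antisym n T (indic (tabloid n T)) t"
    unfolding polytabloid_def column_antisym_def by (intro sum.cong refl) (simp add: perm_act_def)
qed

text \<open>
  Tableaux are functions on all natural numbers; the same filling of a shape is represented by many
  of them, which differ only outside the set of entries.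
\<close>

lemma polytabloid_cong:
  assumes "\<And>x. x < n \<Longrightarrow> T x = T' x"
  shows "polytabloid n T = polytabloid n T'"
proof -
  have c: "column_stabilizer n T = column_stabilizer n T'"
    using assms sym_grp_less by (auto simp: column_stabilizer_def)
  have "tabloid n (T \<circ> inv \<pi>) = tabloid n (T' \<circ> inv \<pi>)" if "\<pi> \<in> column_stabilizer n T" for \<pi>
    using assms sym_grp_less[OF inv_sym_grp[OF column_stabilizer_sym_grp[OF that]]]
    by (simp add: tabloid_def fun_eq_iff)
  thus ?thesis by (simp add: polytabloid_def c cong: sum.cong)
qed

lemma perm_act_polytabloid_column:
  assumes p: "\<pi> \<in> column_stabilizer n T"
  shows "perm_act \<pi> (polytabloid n T) = cscale (of_int (sign \<pi>)) (polytabloid n T)"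
proof
  fix t
  have g: "\<rho> \<in> column_stabilizer n T \<Longrightarrow> \<rho> \<in> sym_grp n" for \<rho>
    by (rule column_stabilizer_sym_grp)
  have 1: "\<pi> \<circ> (inv \<pi> \<circ> \<rho>) = \<rho>" "inv \<pi> \<circ> (\<pi> \<circ> \<rho>) = \<rho>" for \<rho> :: "nat \<Rightarrow> nat"
    by (simp_all add: inv_comp_sym_grp[OF g[OF p]] flip: comp_assoc)
  let ?f = "indic (tabloid n T)"
  have "perm_act \<pi> (column_antisym n T ?f) t
      = (\<Sum>\<rho>\<in>column_stabilizer n T. of_int (sign \<pi>) * (of_int (sign (\<pi> \<circ> \<rho>)) * ?f (t \<circ> (\<pi> \<circ> \<rho>))))"
    unfolding column_antisym_def perm_act_def
    by (intro sum.cong refl) (simp add: sign_comp_cancel[OF g[OF p] g] comp_assoc)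
  also have "\<dots> = of_int (sign \<pi>) * (\<Sum>\<rho>\<in>column_stabilizer n T. of_int (sign (\<pi> \<circ> \<rho>)) * ?f (t \<circ> (\<pi> \<circ> \<rho>)))"
    by (simp add: sum_distrib_left)
  also have "(\<Sum>\<rho>\<in>column_stabilizer n T. of_int (sign (\<pi> \<circ> \<rho>)) * ?f (t \<circ> (\<pi> \<circ> \<rho>)))
      = (\<Sum>\<rho>\<in>column_stabilizer n T. of_int (sign \<rho>) * ?f (t \<circ> \<rho>))"
    by (rule sum.reindex_bij_witness[where i = "\<lambda>\<rho>. inv \<pi> \<circ> \<rho>" and j = "\<lambda>\<rho>. \<pi> \<circ> \<rho>"])
       (simp_all add: 1 column_stabilizer_comp p column_stabilizer_inv)
  finally show "perm_act \<pi> (polytabloid n T) t = cscale (of_int (sign \<pi>)) (polytabloid n T) t"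
    by (simp only: cscale_def column_antisym_def polytabloid_eq_column_antisym)
qed

lemma column_antisym_polytabloid:
  "column_antisym n T (polytabloid n T) = cscale (of_nat (card (column_stabilizer n T))) (polytabloid n T)"
proof
  fix t
  have "of_int (sign \<pi>) * polytabloid n T (t \<circ> \<pi>) = polytabloid n T t"
    if "\<pi> \<in> column_stabilizer n T" for \<pi>
    using fun_cong[OF perm_act_polytabloid_column[OF that], of t]
    by (simp add: perm_act_def cscale_def sign_cancel)
  thus "column_antisym n T (polytabloid n T) t
      = cscale (of_nat (card (column_stabilizer n T))) (polytabloid n T) t"
    by (simp add: column_antisym_def cscale_def)
qed

lemma card_column_stabilizer_pos: "card (column_stabilizer n T) > 0"
proof -
  have "id \<in> column_stabilizer n T" by (simp add: column_stabilizer_def)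
  thus ?thesis using card_gt_0_iff finite_column_stabilizer by blast
qed

text \<open>
  The transposition of two entries in one column of \<open>T\<close> reverses the sign of the signed sum, but it
  fixes the tabloid of \<open>S\<close> when the entries share a row of \<open>S\<close>.
\<close>

lemma column_antisym_indic_eq_0:
  assumes "x < n" "y < n" "x \<noteq> y" "snd (T x) = snd (T y)" "fst (S x) = fst (S y)"
  shows "column_antisym n T (indic (tabloid n S)) = 0"
proof -
  let ?\<tau> = "Transposition.transpose x y"
  have s: "?\<tau> \<in> sym_grp n" using assms by (simp add: sym_grp_def permutes_swap_id)
  have c: "?\<tau> \<in> column_stabilizer n T"
    using s assms by (auto simp: column_stabilizer_def Transposition.transpose_def)
  have "tabloid n S \<circ> inv ?\<tau> = tabloid n S"
    using assms by (auto simp: fun_eq_iff tabloid_def Transposition.transpose_def)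
  hence eq: "column_antisym n T (indic (tabloid n S))
      = cscale (of_int (sign ?\<tau>)) (column_antisym n T (indic (tabloid n S)))"
    using column_antisym_perm_act[OF c, of "indic (tabloid n S)"] perm_act_indic[OF s, of "tabloid n S"] by simp
  have "column_antisym n T (indic (tabloid n S)) t + column_antisym n T (indic (tabloid n S)) t = 0" for t
    by (subst eq) (simp add: cscale_def sign_swap_id assms(3))
  thus ?thesis by (simp add: fun_eq_iff flip: mult_2)
qed

text \<open>
  Either some pair of entries shares a column of \<open>T\<close> and a row of \<open>S\<close>, and the signed sum vanishes; or
  straightening makes the tabloid of \<open>S\<close> a column permutation of the tabloid of \<open>T\<close>, and the signed
  sum is \<open>\<plusminus>\<close> the polytabloid.
\<close>

lemma column_antisym_indic:
  assumes la: "la \<in> partitions n" and T: "T \<in> tableaux la"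
    and mu: "mu \<in> partitions n" and S: "S \<in> tableaux mu"
    and w: "row_weight mu \<le> row_weight la"
  shows "\<exists>c. (la \<noteq> mu \<longrightarrow> c = 0) \<and>
           column_antisym n T (indic (tabloid n S)) = cscale c (polytabloid n T)"
proof (cases "\<exists>x y. x < n \<and> y < n \<and> x \<noteq> y \<and> snd (T x) = snd (T y) \<and> fst (S x) = fst (S y)")
  case True
  hence "column_antisym n T (indic (tabloid n S)) = 0" using column_antisym_indic_eq_0 by blast
  thus ?thesis by (intro exI[of _ 0]) (simp add: cscale_def fun_eq_iff)
next
  case False
  then obtain \<pi> where p: "la = mu" "\<pi> \<in> column_stabilizer n T" "tabloid n (T \<circ> inv \<pi>) = tabloid n S"
    using straighten_tabloid[OF la T mu S w] by metis
  have "indic (tabloid n S) = perm_act \<pi> (indic (tabloid n T))"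
    using p column_stabilizer_sym_grp[OF p(2)] by (simp add: perm_act_indic tabloid_comp flip: p(3))
  thus ?thesis
    using column_antisym_perm_act[OF p(2)] p(1) polytabloid_eq_column_antisym by metis
qed

lemma column_antisym_supported:
  assumes la: "la \<in> partitions n" and T: "T \<in> tableaux la" and mu: "mu \<in> partitions n"
    and w: "row_weight mu \<le> row_weight la" and f: "supported_on_shape n mu f"
  shows "\<exists>c. (la \<noteq> mu \<longrightarrow> c = 0) \<and> column_antisym n T f = cscale c (polytabloid n T)"
proof -
  let ?X = "tabloid n ` tableaux mu"
  have finX: "finite ?X"
    by (rule finite_subset[of _ "tabloid_space n"]) (use tabloid_in_space[OF mu] in auto)
  have "\<forall>s\<in>?X. \<exists>c. (la \<noteq> mu \<longrightarrow> c = 0) \<and> column_antisym n T (indic s) = cscale c (polytabloid n T)"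
    using column_antisym_indic[OF la T mu _ w] by blast
  from bchoice[OF this] obtain c where c: "\<And>s. s \<in> ?X \<Longrightarrow> (la \<noteq> mu \<longrightarrow> c s = 0) \<and>
      column_antisym n T (indic s) = cscale (c s) (polytabloid n T)"
    by blast
  have f_eq: "f t = (\<Sum>s\<in>?X. f s * indic s t)" for t
  proof -
    have "(\<Sum>s\<in>?X. f s * indic s t) = (\<Sum>s\<in>?X. if t = s then f s else 0)"
      by (intro sum.cong refl) (simp add: indic_def)
    also have "\<dots> = (if t \<in> ?X then f t else 0)"
      by (rule sum.delta'[OF finX])
    also have "\<dots> = f t"
      using f unfolding supported_on_shape_def by metis
    finally show ?thesis by simp
  qed
  have "column_antisym n T f t = cscale (\<Sum>s\<in>?X. f s * c s) (polytabloid n T) t" for t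
  proof -
    have "column_antisym n T f t = (\<Sum>\<pi>\<in>column_stabilizer n T. \<Sum>s\<in>?X. of_int (sign \<pi>) * (f s * indic s (t \<circ> \<pi>)))"
      unfolding column_antisym_def sum_distrib_left[symmetric] by (rule sum.cong[OF refl]) (rule arg_cong[OF f_eq])
    also have "\<dots> = (\<Sum>s\<in>?X. \<Sum>\<pi>\<in>column_stabilizer n T. of_int (sign \<pi>) * (f s * indic s (t \<circ> \<pi>)))"
      by (rule sum.swap)
    also have "\<dots> = (\<Sum>s\<in>?X. f s * column_antisym n T (indic s) t)"
      unfolding column_antisym_def sum_distrib_left by (intro sum.cong refl) simp
    also have "\<dots> = (\<Sum>s\<in>?X. (f s * c s) * polytabloid n T t)"
      by (intro sum.cong refl) (simp add: c cscale_def)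
    finally show ?thesis by (simp only: cscale_def sum_distrib_right)
  qed
  hence "column_antisym n T f = cscale (\<Sum>s\<in>?X. f s * c s) (polytabloid n T)" by blast
  moreover have "la \<noteq> mu \<longrightarrow> (\<Sum>s\<in>?X. f s * c s) = 0" using c by simp
  ultimately show ?thesis by blast
qed

lemma supported_perm_act:
  assumes "\<sigma> \<in> sym_grp n" "la \<in> partitions n" "supported_on_shape n la f"
  shows "supported_on_shape n la (perm_act \<sigma> f)"
  unfolding supported_on_shape_def
proof (intro allI impI)
  fix t assume "perm_act \<sigma> f t \<noteq> 0"
  then obtain T where T: "T \<in> tableaux la" "t \<circ> \<sigma> = tabloid n T"
    using assms(3) by (auto simp: supported_on_shape_def perm_act_def)
  have "t = tabloid n (T \<circ> inv \<sigma>)"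
    unfolding tabloid_comp[OF inv_sym_grp[OF assms(1)]] T(2)[symmetric] comp_assoc
    by (simp add: inv_comp_sym_grp[OF assms(1)])
  moreover have "T \<circ> inv \<sigma> \<in> tableaux la"
    using tableaux_comp_permutes[OF T(1) assms(2)] inv_sym_grp[OF assms(1)] by (simp add: sym_grp_def)
  ultimately show "t \<in> tabloid n ` tableaux la" by blast
qed

lemma supported_specht:
  assumes "la \<in> partitions n" "f \<in> specht la"
  shows "supported_on_shape n la f"
proof -
  have n: "sum_list la = n" using assms(1) by (rule sum_list_partition)
  have base: "supported_on_shape n la (polytabloid n T)" if "T \<in> tableaux la" for T
    unfolding supported_on_shape_def
  proof (intro allI impI)
    fix t assume "polytabloid n T t \<noteq> 0"
    then obtain \<pi> where p: "\<pi> \<in> column_stabilizer n T"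
      and "of_int (sign \<pi>) * (if t = tabloid n (T \<circ> inv \<pi>) then 1 else 0) \<noteq> (0::complex)"
      unfolding polytabloid_def by (rule sum.not_neutral_contains_not_neutral)
    hence "t = tabloid n (T \<circ> inv \<pi>)" by (simp split: if_splits)
    moreover have "T \<circ> inv \<pi> \<in> tableaux la"
      using tableaux_comp_permutes[OF that assms(1)] inv_sym_grp[OF column_stabilizer_sym_grp[OF p]]
      by (simp add: sym_grp_def)
    ultimately show "t \<in> tabloid n ` tableaux la" by blast
  qed
  show ?thesis
    using assms(2) unfolding specht_def n
  proof (induction rule: cfun.span_induct_alt)
    case base
    show ?case by (simp add: supported_on_shape_def)
  next
    case (step c x y)
    then obtain T where "T \<in> tableaux la" "x = polytabloid n T" by blast
    hence x: "supported_on_shape n la x" using base by simp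
    show ?case
      unfolding supported_on_shape_def
    proof (intro allI impI)
      fix t assume "(cscale c x + y) t \<noteq> 0"
      hence "x t \<noteq> 0 \<or> y t \<noteq> 0" by (auto simp: cscale_def)
      thus "t \<in> tabloid n ` tableaux la"
        using x step.IH unfolding supported_on_shape_def by blast
    qed
  qed
qed

section \<open>Averaged operators act on Specht modules as scalars\<close>

text \<open>
  The sum over the group of the conjugates of the rank-one operator \<open>y \<mapsto> \<langle>u, y\<rangle> v\<close>. It commutes with
  the group, and its matrix coefficients are the sums that occur in the orthogonality relations.
\<close>

definition avg :: "nat \<Rightarrow> ((nat \<Rightarrow> nat) \<Rightarrow> complex) \<Rightarrow> ((nat \<Rightarrow> nat) \<Rightarrow> complex) \<Rightarrow>
    ((nat \<Rightarrow> nat) \<Rightarrow> complex) \<Rightarrow> ((nat \<Rightarrow> nat) \<Rightarrow> complex)" where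
  "avg n u v y = (\<lambda>t. \<Sum>\<sigma>\<in>sym_grp n. form n (perm_act \<sigma> u) y * perm_act \<sigma> v t)"

lemma avg_perm_act:
  assumes "\<rho> \<in> sym_grp n"
  shows "avg n u v (perm_act \<rho> y) = perm_act \<rho> (avg n u v y)"
proof
  fix t
  have "avg n u v (perm_act \<rho> y) t
      = (\<Sum>\<sigma>\<in>sym_grp n. form n (perm_act (\<rho> \<circ> \<sigma>) u) (perm_act \<rho> y) * perm_act (\<rho> \<circ> \<sigma>) v t)"
    unfolding avg_def by (rule sum_sym_grp_left[OF assms, symmetric])
  also have "\<dots> = (\<Sum>\<sigma>\<in>sym_grp n. form n (perm_act \<sigma> u) y * perm_act \<sigma> v (t \<circ> \<rho>))"
    unfolding perm_act_comp[symmetric] form_perm_act[OF assms]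
    by (simp add: perm_act_def)
  finally show "avg n u v (perm_act \<rho> y) t = perm_act \<rho> (avg n u v y) t"
    by (simp add: avg_def perm_act_def)
qed

lemma avg_cscale: "avg n u v (cscale c y) = cscale c (avg n u v y)"
  unfolding avg_def form_cscale_right by (simp add: cscale_def sum_distrib_left mult_ac)

lemma avg_add: "avg n u v (x + y) = avg n u v x + avg n u v y"
  by (simp add: avg_def form_def fun_eq_iff distrib_left distrib_right sum.distrib)

lemma avg_column_antisym: "avg n u v (column_antisym n T y) = column_antisym n T (avg n u v y)"
proof
  fix t
  let ?C = "column_stabilizer n T"
  have "column_antisym n T y = (\<lambda>t. \<Sum>\<pi>\<in>?C. of_int (sign \<pi>) * perm_act \<pi> y t)"
    by (simp add: column_antisym_def perm_act_def)
  hence "avg n u v (column_antisym n T y) t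
      = (\<Sum>\<sigma>\<in>sym_grp n. \<Sum>\<pi>\<in>?C. of_int (sign \<pi>) * form n (perm_act \<sigma> u) (perm_act \<pi> y) * perm_act \<sigma> v t)"
    by (simp only: avg_def form_sum_right sum_distrib_right)
  also have "\<dots> = (\<Sum>\<pi>\<in>?C. \<Sum>\<sigma>\<in>sym_grp n. of_int (sign \<pi>) * form n (perm_act \<sigma> u) (perm_act \<pi> y) * perm_act \<sigma> v t)"
    by (rule sum.swap)
  also have "\<dots> = (\<Sum>\<pi>\<in>?C. of_int (sign \<pi>) * avg n u v (perm_act \<pi> y) t)"
    by (simp only: avg_def sum_distrib_left mult.assoc)
  also have "\<dots> = (\<Sum>\<pi>\<in>?C. of_int (sign \<pi>) * avg n u v y (t \<circ> \<pi>))"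
    using avg_perm_act[OF column_stabilizer_sym_grp] by (intro sum.cong refl) (simp add: perm_act_def)
  finally show "avg n u v (column_antisym n T y) t = column_antisym n T (avg n u v y) t"
    by (simp add: column_antisym_def)
qed

lemma supported_avg:
  assumes "mu \<in> partitions n" "supported_on_shape n mu v"
  shows "supported_on_shape n mu (avg n u v y)"
  unfolding supported_on_shape_def
proof (intro allI impI)
  fix t assume "avg n u v y t \<noteq> 0"
  then obtain \<sigma> where s: "\<sigma> \<in> sym_grp n" "form n (perm_act \<sigma> u) y * perm_act \<sigma> v t \<noteq> 0"
    unfolding avg_def by (rule sum.not_neutral_contains_not_neutral)
  thus "t \<in> tabloid n ` tableaux mu"
    using supported_perm_act[OF s(1) assms] by (simp add: supported_on_shape_def)
qed

text \<open>
  The polytabloid is, up to a nonzero factor, its own image under the signed column sum. The averaged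
  operator commutes with that sum, so its value at the polytabloid is also in the image of the sum,
  which is the line of the polytabloid or zero.
\<close>

lemma avg_polytabloid:
  assumes la: "la \<in> partitions n" and T: "T \<in> tableaux la" and mu: "mu \<in> partitions n"
    and w: "row_weight mu \<le> row_weight la" and v: "supported_on_shape n mu v"
  shows "\<exists>a. (la \<noteq> mu \<longrightarrow> a = 0) \<and> avg n u v (polytabloid n T) = cscale a (polytabloid n T)"
proof -
  let ?e = "polytabloid n T"
  let ?k = "of_nat (card (column_stabilizer n T)) :: complex"
  obtain c where c: "la \<noteq> mu \<longrightarrow> c = 0" "column_antisym n T (avg n u v ?e) = cscale c ?e"
    using column_antisym_supported[OF la T mu w supported_avg[OF mu v]] by blast
  have k: "?k \<noteq> 0" using card_column_stabilizer_pos[of n T] by (metis of_nat_eq_0_iff less_irrefl)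
  have "cscale ?k (avg n u v ?e) = cscale c ?e"
    using c(2) by (simp only: avg_column_antisym[symmetric] column_antisym_polytabloid avg_cscale)
  hence "?k * avg n u v ?e t = c * ?e t" for t
    by (simp add: cscale_def fun_eq_iff)
  hence "avg n u v ?e = cscale (c / ?k) ?e"
    using k by (simp add: cscale_def fun_eq_iff field_simps)
  thus ?thesis using c(1) by (intro exI[of _ "c / ?k"]) simp
qed

lemma polytabloid_in_specht:
  "la \<in> partitions n \<Longrightarrow> T \<in> tableaux la \<Longrightarrow> polytabloid n T \<in> specht la"
  by (auto simp: specht_def sum_list_partition intro: cfun.span_base)

text \<open>
  This is Schur's lemma for Specht modules. The scalar is read off at one polytabloid, and the group
  moves that polytabloid to all others, which span the module.
\<close>

lemma avg_scalar_on_specht: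
  assumes la: "la \<in> partitions n" and v: "supported_on_shape n la v"
  shows "\<exists>a. \<forall>y\<in>specht la. avg n u v y = cscale a y"
proof -
  obtain T where T: "T \<in> tableaux la" using ex_tableau by blast
  obtain a where a: "avg n u v (polytabloid n T) = cscale a (polytabloid n T)"
    using avg_polytabloid[OF la T la order_refl v] by blast
  have base: "avg n u v (polytabloid n T') = cscale a (polytabloid n T')" if T': "T' \<in> tableaux la" for T'
  proof -
    obtain q where q: "q permutes {..<n}" "\<forall>x<n. T (q x) = T' x"
      using tableaux_transitive[OF la T T'] by blast
    have s: "inv q \<in> sym_grp n" "inv (inv q) = q"
      using q(1) by (simp_all add: sym_grp_def permutes_inv permutes_inv_inv)
    have "polytabloid n T' = polytabloid n (T \<circ> inv (inv q))"
      by (rule polytabloid_cong) (simp add: q s)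
    hence "polytabloid n T' = perm_act (inv q) (polytabloid n T)"
      by (simp add: perm_act_polytabloid[OF s(1)])
    thus ?thesis
      by (simp add: avg_perm_act[OF s(1)] a) (simp add: perm_act_def cscale_def)
  qed
  have "avg n u v y = cscale a y" if "y \<in> specht la" for y
    using that unfolding specht_def sum_list_partition[OF la]
  proof (induction rule: cfun.span_induct_alt)
    case base
    show ?case by (simp add: avg_def form_def cscale_def fun_eq_iff)
  next
    case (step c x y)
    then obtain T' where "T' \<in> tableaux la" "x = polytabloid n T'" by blast
    hence "avg n u v x = cscale a x" using base by simp
    hence "avg n u v (cscale c x + y) = cscale c (cscale a x) + cscale a y"
      by (simp only: avg_add avg_cscale step.IH)
    also have "\<dots> = cscale a (cscale c x + y)"
      by (simp add: cscale_def fun_eq_iff distrib_left mult_ac)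
    finally show ?case .
  qed
  thus ?thesis by blast
qed


section \<open>Traces of operators of finite rank\<close>

lemma sum_fun_eq: "(\<lambda>t. \<Sum>i\<in>I. h i t) = (\<Sum>i\<in>I. h i)"
  for h :: "'i \<Rightarrow> 'a \<Rightarrow> complex"
  by (induction I rule: infinite_finite_induct) (auto simp: fun_eq_iff)

lemma span_finite_support:
  fixes f :: "'a \<Rightarrow> complex"
  assumes "finite X" "\<And>t. f t \<noteq> 0 \<Longrightarrow> t \<in> X"
  shows "f \<in> cfun.span (indic ` X)"
proof -
  have "f t = (\<Sum>s\<in>X. cscale (f s) (indic s) t)" for t
  proof -
    have "(\<Sum>s\<in>X. cscale (f s) (indic s) t) = (\<Sum>s\<in>X. if t = s then f s else 0)"
      by (intro sum.cong refl) (simp add: indic_def cscale_def)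
    also have "\<dots> = f t"
      using assms(2)[of t] by (auto simp: sum.delta'[OF assms(1)])
    finally show ?thesis by simp
  qed
  hence "f = (\<Sum>s\<in>X. cscale (f s) (indic s))"
    unfolding sum_fun_eq[symmetric] by blast
  also have "\<dots> \<in> cfun.span (indic ` X)"
    by (intro cfun.span_sum cfun.span_scale cfun.span_base) auto
  finally show ?thesis .
qed

text \<open>
  Each rank-one term contributes the functional applied to its vector, whichever basis the definition
  of the trace selects, since a vector is recovered from its coordinates.
\<close>

lemma trace_on_finite_rank:
  assumes V: "V = cfun.span G" and supp: "\<And>f t. f \<in> V \<Longrightarrow> f t \<noteq> 0 \<Longrightarrow> t \<in> tabloid_space n"
    and w: "\<And>i. i \<in> I \<Longrightarrow> w i \<in> V"
    and A: "\<And>y. y \<in> V \<Longrightarrow> A y = (\<lambda>t. \<Sum>i\<in>I. form n (g i) y * w i t)"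
  shows "trace_on V A = (\<Sum>i\<in>I. form n (g i) (w i))"
proof -
  define B where "B = (SOME B. cfun.independent B \<and> cfun.span B = V)"
  obtain B0 where "cfun.independent B0" "cfun.span B0 = cfun.span V"
    by (metis cfun.basis_exists cfun.span_subspace cfun.span_eq cfun.span_mono cfun.span_span subset_antisym)
  hence "cfun.independent B0 \<and> cfun.span B0 = V" by (simp add: V)
  hence B: "cfun.independent B" "cfun.span B = V"
    unfolding B_def by (metis (mono_tags, lifting) someI)+
  have "B \<subseteq> cfun.span (indic ` tabloid_space n)"
    using supp B(2) cfun.span_base[of _ B] by (auto intro!: span_finite_support)
  hence finB: "finite B"
    using cfun.independent_span_bound[OF finite_imageI[OF finite_tabloid_space] B(1)] by blast
  let ?r = "cfun.representation B"
  have rep: "(\<lambda>t. \<Sum>b\<in>B. ?r y b * b t) = y" if "y \<in> V" for y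
    using cfun.sum_representation_eq[OF B(1) _ finB order_refl, of y] that B(2)
    unfolding sum_fun_eq[symmetric] by (simp add: cscale_def)
  have "?r (A b) b = (\<Sum>i\<in>I. form n (g i) b * ?r (w i) b)" if "b \<in> B" for b
  proof -
    have "b \<in> V" using that B(2) cfun.span_base by blast
    hence "A b = (\<Sum>i\<in>I. cscale (form n (g i) b) (w i))"
      using A unfolding sum_fun_eq[symmetric] by (simp add: cscale_def)
    moreover have "?r (\<Sum>i\<in>I. cscale (form n (g i) b) (w i))
        = (\<lambda>b'. \<Sum>i\<in>I. ?r (cscale (form n (g i) b) (w i)) b')"
      by (rule cfun.representation_sum[OF B(1)]) (use w B(2) cfun.span_scale in blast)
    moreover have "?r (cscale (form n (g i) b) (w i)) b = form n (g i) b * ?r (w i) b" if "i \<in> I" for i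
      using cfun.representation_scale[OF B(1), of "w i"] w[OF that] B(2) by simp
    ultimately show ?thesis by simp
  qed
  hence "trace_on V A = (\<Sum>b\<in>B. \<Sum>i\<in>I. form n (g i) b * ?r (w i) b)"
    by (simp add: trace_on_def Let_def flip: B_def)
  also have "\<dots> = (\<Sum>i\<in>I. \<Sum>b\<in>B. ?r (w i) b * form n (g i) b)"
    by (subst sum.swap) (simp add: mult.commute)
  also have "\<dots> = (\<Sum>i\<in>I. form n (g i) (w i))"
    by (intro sum.cong refl) (simp add: rep w flip: form_sum_right)
  finally show ?thesis .
qed

lemma specht_trace:
  assumes la: "la \<in> partitions n" and w: "\<And>i. i \<in> I \<Longrightarrow> w i \<in> specht la"
    and A: "\<And>y. y \<in> specht la \<Longrightarrow> A y = (\<lambda>t. \<Sum>i\<in>I. form n (g i) y * w i t)"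
  shows "trace_on (specht la) A = (\<Sum>i\<in>I. form n (g i) (w i))"
proof (rule trace_on_finite_rank[OF specht_def _ w A])
  fix f t assume "f \<in> specht la" "f t \<noteq> 0"
  thus "t \<in> tabloid_space n"
    using supported_specht[OF la] tabloid_in_space[OF la] unfolding supported_on_shape_def by blast
qed

section \<open>Character formula and orthogonality\<close>

lemma polytabloid_real: "polytabloid n T t \<in> \<real>"
  unfolding polytabloid_def by (intro sum_in_Reals Reals_mult) auto

text \<open>
  Only the identity preserves both the rows and the columns of a tableau. In particular polytabloids
  are nonzero.
\<close>

lemma polytabloid_at_tabloid:
  assumes la: "la \<in> partitions n" and T: "T \<in> tableaux la"
  shows "polytabloid n T (tabloid n T) = 1"
proof -
  have b: "inj_on T {..<n}" using tableaux_bij[OF T la] by (simp add: bij_betw_def)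
  have "(tabloid n T = tabloid n (T \<circ> inv \<pi>)) \<longleftrightarrow> \<pi> = id" if p: "\<pi> \<in> column_stabilizer n T" for \<pi>
  proof
    assume eq: "tabloid n T = tabloid n (T \<circ> inv \<pi>)"
    have s: "inv \<pi> \<in> sym_grp n" using column_stabilizer_sym_grp[OF p] by simp
    have "inv \<pi> x = x" if "x < n" for x
    proof -
      have "T (inv \<pi> x) = T x"
        using fun_cong[OF eq, of x] that column_stabilizer_inv[OF p]
        by (simp add: tabloid_def column_stabilizer_def prod_eq_iff)
      thus ?thesis using inj_onD[OF b] that sym_grp_less[OF s that] by simp
    qed
    moreover have "inv \<pi> x = x" if "\<not> x < n" for x
      using s that permutes_not_in[of "inv \<pi>" "{..<n}" x] by (simp add: sym_grp_def)
    ultimately have "inv \<pi> = id" by (simp add: fun_eq_iff) blast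
    thus "\<pi> = id" using inv_comp_sym_grp(3)[OF column_stabilizer_sym_grp[OF p]] by simp
  qed simp
  hence "polytabloid n T (tabloid n T)
      = (\<Sum>\<pi>\<in>column_stabilizer n T. if \<pi> = id then of_int (sign \<pi>) else 0)"
    unfolding polytabloid_def by (intro sum.cong refl) simp
  also have "\<dots> = 1"
    by (simp add: column_stabilizer_def sign_id flip: id_def)
  finally show ?thesis .
qed

lemma form_real:
  assumes "\<And>t. f t \<in> \<real>" "\<And>t. g t \<in> \<real>"
  shows "form n f g \<in> \<real>"
  unfolding form_def using assms by (intro sum_in_Reals Reals_mult)

lemma form_self_real:
  assumes "\<And>t. f t \<in> \<real>"
  shows "form n f f = of_real (\<Sum>t\<in>tabloid_space n. (cmod (f t))\<^sup>2)"
proof -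
  have "f t * f t = of_real ((cmod (f t))\<^sup>2)" for t
    using assms[of t] by (auto elim!: Reals_cases simp: power2_eq_square norm_mult simp flip: of_real_mult)
  thus ?thesis by (simp add: form_def)
qed

lemma form_zero [simp]: "form n 0 g = 0"
  by (simp add: form_def)

lemma avg_form: "form n (avg n u v y) x = (\<Sum>\<sigma>\<in>sym_grp n. form n (perm_act \<sigma> u) y * form n (perm_act \<sigma> v) x)"
  unfolding avg_def form_commute[of n _ x] form_sum_right ..

lemma perm_act_in_specht:
  "la \<in> partitions n \<Longrightarrow> \<sigma> \<in> sym_grp n \<Longrightarrow> f \<in> specht la \<Longrightarrow> perm_act \<sigma> f \<in> specht la"
  using perm_act_specht by (simp add: sum_list_partition)

text \<open>
  The operator that sums the orthogonal projections, up to scale, onto the translates of \<open>e\<close> is a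
  positive scalar \<open>c\<close> on the Specht module. Dividing by \<open>c\<close> writes the identity, and hence the action of
  any \<open>\<sigma>\<close>, as a sum of rank-one operators whose trace is visible.
\<close>

lemma irr_char_formula:
  assumes la: "la \<in> partitions n" and T: "T \<in> tableaux la"
  defines "e \<equiv> polytabloid n T"
  shows "\<exists>c>0. (\<forall>y\<in>specht la. avg n e e y = cscale (of_real c) y) \<and>
    (\<forall>\<sigma>\<in>sym_grp n. irr_char la \<sigma> =
       (\<Sum>\<rho>\<in>sym_grp n. form n (perm_act \<sigma> (perm_act \<rho> e)) (perm_act \<rho> e)) / of_real c)"
proof -
  have e: "e \<in> specht la" unfolding e_def by (rule polytabloid_in_specht[OF la T])
  have er: "e t \<in> \<real>" for t unfolding e_def by (rule polytabloid_real)
  obtain a where a: "\<forall>y\<in>specht la. avg n e e y = cscale a y"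
    using avg_scalar_on_specht[OF la supported_specht[OF la e]] by blast
  define E where "E = (\<Sum>t\<in>tabloid_space n. (cmod (e t))\<^sup>2)"
  have E: "form n e e = of_real E" unfolding E_def by (rule form_self_real[OF er])
  have "0 < (cmod (e (tabloid n T)))\<^sup>2"
    using polytabloid_at_tabloid[OF la T] by (simp add: e_def)
  hence Epos: "E > 0"
    unfolding E_def using tabloid_in_space[OF la T] by (intro sum_pos2) auto
  define F where "F \<sigma> = Re (form n (perm_act \<sigma> e) e)" for \<sigma>
  have F: "form n (perm_act \<sigma> e) e = of_real (F \<sigma>)" for \<sigma>
    unfolding F_def by (rule of_real_Re[symmetric], rule form_real) (simp_all add: er perm_act_def)
  \<comment> \<open>The scalar is determined by pairing the image of \<open>e\<close> with \<open>e\<close>; both the numerator and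
    the denominator are sums of squares.\<close>
  define c where "c = (\<Sum>\<sigma>\<in>sym_grp n. (F \<sigma>)\<^sup>2) / E"
  have "a * of_real E = form n (avg n e e e) e"
    using a e by (simp add: form_cscale_left E)
  also have "\<dots> = of_real (\<Sum>\<sigma>\<in>sym_grp n. (F \<sigma>)\<^sup>2)"
    by (simp add: avg_form F power2_eq_square)
  finally have ac: "a = of_real c"
    using Epos by (simp add: c_def field_simps)
  have "F id = E" by (simp add: F_def E)
  hence "(\<Sum>\<sigma>\<in>sym_grp n. (F \<sigma>)\<^sup>2) > 0"
    using Epos by (intro sum_pos2[of _ id]) auto
  hence c: "c > 0" using Epos by (simp add: c_def)
  have "irr_char la \<sigma> = (\<Sum>\<rho>\<in>sym_grp n. form n (perm_act \<sigma> (perm_act \<rho> e)) (perm_act \<rho> e)) / of_real c"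
    if s: "\<sigma> \<in> sym_grp n" for \<sigma>
  proof -
    have "irr_char la \<sigma>
        = (\<Sum>\<rho>\<in>sym_grp n. form n (cscale (1 / of_real c) (perm_act \<rho> e)) (perm_act \<sigma> (perm_act \<rho> e)))"
      unfolding irr_char_def
    proof (rule specht_trace[OF la])
      show "perm_act \<sigma> (perm_act \<rho> e) \<in> specht la" if "\<rho> \<in> sym_grp n" for \<rho>
        using la s that e by (intro perm_act_in_specht)
      fix y assume "y \<in> specht la"
      hence "avg n e e y t = of_real c * y t" for t
        using a ac by (simp add: cscale_def)
      hence "y t = (\<Sum>\<rho>\<in>sym_grp n. form n (perm_act \<rho> e) y * perm_act \<rho> e t) / of_real c" for t
        using c by (simp add: avg_def)
      thus "perm_act \<sigma> y = (\<lambda>t. \<Sum>\<rho>\<in>sym_grp n. form n (cscale (1 / of_real c) (perm_act \<rho> e)) y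
                                  * perm_act \<sigma> (perm_act \<rho> e) t)"
        by (simp add: perm_act_def[of \<sigma>] form_cscale_left sum_divide_distrib)
    qed
    thus ?thesis
      by (simp add: form_cscale_left form_commute[of n "perm_act \<sigma> _"] sum_divide_distrib)
  qed
  thus ?thesis using c a ac by blast
qed

lemma irr_char_real:
  assumes la: "la \<in> partitions n" and s: "\<sigma> \<in> sym_grp n"
  shows "irr_char la \<sigma> \<in> \<real>"
proof -
  obtain T where T: "T \<in> tableaux la" using ex_tableau by blast
  obtain c where "irr_char la \<sigma> = (\<Sum>\<rho>\<in>sym_grp n.
      form n (perm_act \<sigma> (perm_act \<rho> (polytabloid n T))) (perm_act \<rho> (polytabloid n T))) / of_real c"
    using irr_char_formula[OF la T] s by blast
  thus ?thesis
    by (auto intro!: Reals_divide sum_in_Reals form_real polytabloid_real simp: perm_act_def)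
qed

lemma irr_char_conj:
  assumes la: "la \<in> partitions n" and s: "\<sigma> \<in> sym_grp n" and r: "\<tau> \<in> sym_grp n"
  shows "irr_char la (inv \<tau> \<circ> \<sigma> \<circ> \<tau>) = irr_char la \<sigma>"
proof -
  obtain T where T: "T \<in> tableaux la" using ex_tableau by blast
  define e where "e = polytabloid n T"
  obtain c where c: "\<And>\<sigma>. \<sigma> \<in> sym_grp n \<Longrightarrow> irr_char la \<sigma> =
      (\<Sum>\<rho>\<in>sym_grp n. form n (perm_act \<sigma> (perm_act \<rho> e)) (perm_act \<rho> e)) / of_real c"
    using irr_char_formula[OF la T] unfolding e_def by blast
  have "form n (perm_act (inv \<tau> \<circ> \<sigma> \<circ> \<tau>) (perm_act \<rho> e)) (perm_act \<rho> e)
      = form n (perm_act \<sigma> (perm_act (\<tau> \<circ> \<rho>) e)) (perm_act (\<tau> \<circ> \<rho>) e)" for \<rho>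
    using form_perm_act_left[OF inv_sym_grp[OF r], of "perm_act (\<sigma> \<circ> \<tau> \<circ> \<rho>) e" "perm_act \<rho> e"]
    by (simp add: perm_act_comp comp_assoc inv_comp_sym_grp[OF r])
  hence "irr_char la (inv \<tau> \<circ> \<sigma> \<circ> \<tau>)
      = (\<Sum>\<rho>\<in>sym_grp n. form n (perm_act \<sigma> (perm_act (\<tau> \<circ> \<rho>) e)) (perm_act (\<tau> \<circ> \<rho>) e)) / of_real c"
    using s r by (subst c) auto
  also have "(\<Sum>\<rho>\<in>sym_grp n. form n (perm_act \<sigma> (perm_act (\<tau> \<circ> \<rho>) e)) (perm_act (\<tau> \<circ> \<rho>) e))
      = (\<Sum>\<rho>\<in>sym_grp n. form n (perm_act \<sigma> (perm_act \<rho> e)) (perm_act \<rho> e))"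
    by (rule sum_sym_grp_left[OF r])
  finally show ?thesis by (simp only: c[OF s])
qed

text \<open>
  The Cauchy--Schwarz inequality, in the form \<open>x y \<le> (x\<^sup>2 + y\<^sup>2) / 2\<close> because both functions have the same
  norm.
\<close>

lemma cmod_form_perm_act_le:
  assumes s: "\<sigma> \<in> sym_grp n" and f: "\<And>t. f t \<in> \<real>"
  shows "cmod (form n (perm_act \<sigma> f) f) \<le> Re (form n f f)"
proof -
  have fr: "perm_act \<sigma> f t \<in> \<real>" for t using f by (simp add: perm_act_def)
  have am_gm: "x * y \<le> (x\<^sup>2 + y\<^sup>2) / 2" for x y :: real
    using sum_squares_bound[of x y] by simp
  have "cmod (form n (perm_act \<sigma> f) f) \<le> (\<Sum>t\<in>tabloid_space n. cmod (perm_act \<sigma> f t) * cmod (f t))"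
    unfolding form_def by (rule order_trans[OF norm_sum]) (simp add: norm_mult)
  also have "\<dots> \<le> (\<Sum>t\<in>tabloid_space n. ((cmod (perm_act \<sigma> f t))\<^sup>2 + (cmod (f t))\<^sup>2) / 2)"
    by (intro sum_mono am_gm)
  also have "\<dots> = (Re (form n (perm_act \<sigma> f) (perm_act \<sigma> f)) + Re (form n f f)) / 2"
    unfolding form_self_real[OF fr] form_self_real[OF f]
    by (simp only: Re_complex_of_real sum.distrib[symmetric] sum_divide_distrib[symmetric])
  also have "\<dots> = Re (form n f f)" by (simp add: form_perm_act[OF s])
  finally show ?thesis .
qed

lemma cmod_irr_char_le_dim:
  assumes la: "la \<in> partitions n" and s: "\<sigma> \<in> sym_grp n"
  shows "cmod (irr_char la \<sigma>) \<le> real (char_dim la)"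
proof -
  obtain T where T: "T \<in> tableaux la" using ex_tableau by blast
  define e where "e = polytabloid n T"
  obtain c where cpos: "c > 0" and c: "\<And>\<sigma>. \<sigma> \<in> sym_grp n \<Longrightarrow> irr_char la \<sigma> =
      (\<Sum>\<rho>\<in>sym_grp n. form n (perm_act \<sigma> (perm_act \<rho> e)) (perm_act \<rho> e)) / of_real c"
    using irr_char_formula[OF la T] unfolding e_def by blast
  have er: "perm_act \<rho> e t \<in> \<real>" for t \<rho> by (simp add: e_def perm_act_def polytabloid_real)
  have "cmod (irr_char la \<sigma>)
      \<le> (\<Sum>\<rho>\<in>sym_grp n. Re (form n (perm_act \<rho> e) (perm_act \<rho> e))) / c"
    unfolding c[OF s] norm_divide using cpos
    by (simp, intro divide_right_mono order_trans[OF norm_sum] sum_mono cmod_form_perm_act_le[OF s])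
       (simp_all add: er)
  also have "\<dots> = Re (irr_char la id)"
    unfolding c[OF id_sym_grp] by (simp flip: of_real_divide)
  finally show ?thesis by (simp add: irr_char_id)
qed

text \<open>
  The sum is a matrix coefficient of an operator between the two permutation modules that commutes
  with the group. It vanishes when the operator goes from the shape of larger row weight to the other
  one, and exchanging the factors of the product reverses the direction.
\<close>

lemma matrix_coefficients_orthogonal:
  assumes la: "la \<in> partitions n" and mu: "mu \<in> partitions n" and ne: "la \<noteq> mu"
    and T: "T \<in> tableaux la" and S: "S \<in> tableaux mu"
  defines "u \<equiv> polytabloid n T" and "v \<equiv> polytabloid n S"
  shows "(\<Sum>\<sigma>\<in>sym_grp n. form n (perm_act \<sigma> u) u * form n (perm_act \<sigma> v) v) = 0"
proof -
  have su: "supported_on_shape n la u" and sv: "supported_on_shape n mu v"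
    using supported_specht polytabloid_in_specht la mu T S by (auto simp: u_def v_def)
  consider "row_weight mu \<le> row_weight la" | "row_weight la \<le> row_weight mu" by linarith
  thus ?thesis
  proof cases
    case 1
    hence "avg n u v u = cscale 0 u"
      using avg_polytabloid[OF la T mu 1 sv] ne by (force simp: u_def)
    hence "form n (avg n u v u) v = 0" by (simp add: form_cscale_left)
    thus ?thesis by (simp add: avg_form)
  next
    case 2
    hence "avg n v u v = cscale 0 v"
      using avg_polytabloid[OF mu S la 2 su] ne by (force simp: v_def)
    hence "form n (avg n v u v) u = 0" by (simp add: form_cscale_left)
    thus ?thesis by (simp add: avg_form mult.commute)
  qed
qed

text \<open>
  The averaged operator is a scalar \<open>a\<close>, and its trace is \<open>a\<close> times the dimension. Computed termwise, the
  trace is \<open>n!\<close> times the pairing of \<open>u\<close> and \<open>v\<close>, because all conjugates of the rank-one operator have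
  the same trace.
\<close>

lemma matrix_coefficients_norm:
  assumes la: "la \<in> partitions n" and u: "u \<in> specht la" and v: "v \<in> specht la"
  shows "of_nat (char_dim la) * (\<Sum>\<sigma>\<in>sym_grp n. form n (perm_act \<sigma> u) u * form n (perm_act \<sigma> v) v)
       = fact n * (form n u v)\<^sup>2"
proof -
  obtain a where a: "\<forall>y\<in>specht la. avg n u v y = cscale a y"
    using avg_scalar_on_specht[OF la supported_specht[OF la v]] by blast
  obtain T where T: "T \<in> tableaux la" using ex_tableau by blast
  define e where "e = polytabloid n T"
  obtain c where cpos: "c > 0" and ce: "\<forall>y\<in>specht la. avg n e e y = cscale (of_real c) y"
    and c: "\<And>\<sigma>. \<sigma> \<in> sym_grp n \<Longrightarrow> irr_char la \<sigma> =
      (\<Sum>\<rho>\<in>sym_grp n. form n (perm_act \<sigma> (perm_act \<rho> e)) (perm_act \<rho> e)) / of_real c"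
    using irr_char_formula[OF la T] unfolding e_def by blast
  have e: "e \<in> specht la" unfolding e_def by (rule polytabloid_in_specht[OF la T])
  have "trace_on (specht la) (avg n u v) = (\<Sum>\<sigma>\<in>sym_grp n. form n (perm_act \<sigma> u) (perm_act \<sigma> v))"
    by (rule specht_trace[OF la]) (use perm_act_in_specht[OF la _ v] in \<open>simp_all add: avg_def\<close>)
  also have "\<dots> = fact n * form n u v"
    by (simp add: form_perm_act card_sym_grp)
  finally have 1: "trace_on (specht la) (avg n u v) = fact n * form n u v" .
  have "trace_on (specht la) (avg n u v)
      = (\<Sum>\<rho>\<in>sym_grp n. form n (cscale (a / of_real c) (perm_act \<rho> e)) (perm_act \<rho> e))"
  proof (rule specht_trace[OF la])
    show "perm_act \<rho> e \<in> specht la" if "\<rho> \<in> sym_grp n" for \<rho>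
      using la that e by (intro perm_act_in_specht)
    fix y assume y: "y \<in> specht la"
    hence "(\<Sum>\<rho>\<in>sym_grp n. form n (perm_act \<rho> e) y * perm_act \<rho> e t) = of_real c * y t" for t
      using fun_cong[OF bspec[OF ce y], of t] by (simp add: cscale_def avg_def)
    hence "(\<Sum>\<rho>\<in>sym_grp n. a / of_real c * (form n (perm_act \<rho> e) y * perm_act \<rho> e t)) = a * y t" for t
      using cpos unfolding sum_distrib_left[symmetric] by simp
    thus "avg n u v y = (\<lambda>t. \<Sum>\<rho>\<in>sym_grp n. form n (cscale (a / of_real c) (perm_act \<rho> e)) y * perm_act \<rho> e t)"
      unfolding bspec[OF a y] form_cscale_left mult.assoc by (simp add: cscale_def)
  qed
  also have "\<dots> = a * irr_char la id"
    unfolding c[OF id_sym_grp] by (simp add: form_cscale_left sum_distrib_left sum_divide_distrib)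
  finally have 2: "a * of_nat (char_dim la) = fact n * form n u v"
    using 1 by (simp add: irr_char_id)
  have "(\<Sum>\<sigma>\<in>sym_grp n. form n (perm_act \<sigma> u) u * form n (perm_act \<sigma> v) v) = a * form n u v"
    using bspec[OF a u] by (simp add: form_cscale_left flip: avg_form)
  thus ?thesis using 2 by (simp add: power2_eq_square mult_ac)
qed

text \<open>
  Inserting the character formula twice turns the sum into a double sum, over translates of the two
  polytabloids, of the sums of products of matrix coefficients. For equal shapes there remains the sum
  of the squared pairings of all translates, which the scalar \<open>c\<close> of the character formula evaluates.
\<close>

lemma irr_char_orthonormal:
  assumes la: "la \<in> partitions n" and mu: "mu \<in> partitions n"
  shows "(\<Sum>\<sigma>\<in>sym_grp n. irr_char la \<sigma> * irr_char mu \<sigma>) = (if la = mu then fact n else 0)"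
proof -
  obtain T where T: "T \<in> tableaux la" using ex_tableau by blast
  obtain S where S: "S \<in> tableaux mu" "la = mu \<Longrightarrow> S = T" using ex_tableau T by metis
  define e where "e = polytabloid n T"
  define f where "f = polytabloid n S"
  obtain c where cpos: "c > 0" and ce: "\<forall>y\<in>specht la. avg n e e y = cscale (of_real c) y"
    and c: "\<And>\<sigma>. \<sigma> \<in> sym_grp n \<Longrightarrow> irr_char la \<sigma> =
      (\<Sum>\<rho>\<in>sym_grp n. form n (perm_act \<sigma> (perm_act \<rho> e)) (perm_act \<rho> e)) / of_real c"
    using irr_char_formula[OF la T] unfolding e_def by blast
  obtain d where d: "\<And>\<sigma>. \<sigma> \<in> sym_grp n \<Longrightarrow> irr_char mu \<sigma> =
      (\<Sum>\<rho>\<in>sym_grp n. form n (perm_act \<sigma> (perm_act \<rho> f)) (perm_act \<rho> f)) / of_real d"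
    using irr_char_formula[OF mu S(1)] unfolding f_def by blast
  define M where "M u v = (\<Sum>\<sigma>\<in>sym_grp n. form n (perm_act \<sigma> u) u * form n (perm_act \<sigma> v) v)" for u v
  have expand: "(\<Sum>\<sigma>\<in>sym_grp n. (\<Sum>\<rho>\<in>sym_grp n. form n (perm_act \<sigma> (perm_act \<rho> e)) (perm_act \<rho> e)) *
      (\<Sum>\<rho>\<in>sym_grp n. form n (perm_act \<sigma> (perm_act \<rho> g)) (perm_act \<rho> g)))
      = (\<Sum>\<rho>\<in>sym_grp n. \<Sum>\<tau>\<in>sym_grp n. M (perm_act \<rho> e) (perm_act \<tau> g))" for g
    unfolding M_def sum_product
    by (rule trans[OF sum.swap], rule sum.cong[OF refl], rule sum.swap)
  show ?thesis
  proof (cases "la = mu")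
    case False
    have "M (perm_act \<rho> e) (perm_act \<tau> f) = 0" if "\<rho> \<in> sym_grp n" "\<tau> \<in> sym_grp n" for \<rho> \<tau>
    proof -
      have "T \<circ> inv \<rho> \<in> tableaux la" "S \<circ> inv \<tau> \<in> tableaux mu"
        using that inv_sym_grp tableaux_comp_permutes T S la mu by (auto simp: sym_grp_def permutes_inv)
      thus ?thesis
        unfolding M_def e_def f_def perm_act_polytabloid[OF that(1)] perm_act_polytabloid[OF that(2)]
        by (rule matrix_coefficients_orthogonal[OF la mu False])
    qed
    hence "(\<Sum>\<rho>\<in>sym_grp n. \<Sum>\<tau>\<in>sym_grp n. M (perm_act \<rho> e) (perm_act \<tau> f)) = 0" by simp
    thus ?thesis
      using False expand[of f] by (simp add: c d flip: sum_divide_distrib)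
  next
    case True
    let ?f = "of_nat (char_dim la) :: complex"
    have e: "perm_act \<rho> e \<in> specht la" if "\<rho> \<in> sym_grp n" for \<rho>
      using la that polytabloid_in_specht[OF la T] unfolding e_def by (intro perm_act_in_specht)
    have "(\<Sum>\<sigma>\<in>sym_grp n. irr_char la \<sigma> * irr_char mu \<sigma>)
        = (\<Sum>\<rho>\<in>sym_grp n. \<Sum>\<tau>\<in>sym_grp n. M (perm_act \<rho> e) (perm_act \<tau> e)) / (of_real c)\<^sup>2"
      using expand[of e] unfolding True[symmetric] by (simp add: c power2_eq_square flip: sum_divide_distrib)
    hence "?f * (\<Sum>\<sigma>\<in>sym_grp n. irr_char la \<sigma> * irr_char mu \<sigma>)
        = (\<Sum>\<rho>\<in>sym_grp n. \<Sum>\<tau>\<in>sym_grp n. ?f * M (perm_act \<rho> e) (perm_act \<tau> e)) / (of_real c)\<^sup>2"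
      by (simp add: sum_distrib_left)
    also have "(\<Sum>\<rho>\<in>sym_grp n. \<Sum>\<tau>\<in>sym_grp n. ?f * M (perm_act \<rho> e) (perm_act \<tau> e))
        = (\<Sum>\<rho>\<in>sym_grp n. \<Sum>\<tau>\<in>sym_grp n. fact n * (form n (perm_act \<rho> e) (perm_act \<tau> e))\<^sup>2)"
      unfolding M_def by (intro sum.cong refl matrix_coefficients_norm[OF la] e)
    also have "\<dots> = (\<Sum>\<tau>\<in>sym_grp n. fact n * form n (avg n e e (perm_act \<tau> e)) (perm_act \<tau> e))"
      by (subst sum.swap) (simp add: avg_form power2_eq_square sum_distrib_left)
    also have "\<dots> = fact n * (of_real c * (\<Sum>\<tau>\<in>sym_grp n. form n (perm_act \<tau> e) (perm_act \<tau> e)))"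
      using ce e by (simp add: form_cscale_left sum_distrib_left cong: sum.cong)
    also have "(\<Sum>\<tau>\<in>sym_grp n. form n (perm_act \<tau> e) (perm_act \<tau> e)) = of_real c * ?f"
      using c[OF id_sym_grp] cpos by (simp add: irr_char_id)
    finally have main: "?f * (\<Sum>\<sigma>\<in>sym_grp n. irr_char la \<sigma> * irr_char mu \<sigma>) = ?f * fact n"
      using cpos by (simp add: power2_eq_square)
    have "?f \<noteq> 0"
    proof
      assume "?f = 0"
      hence "irr_char la id = 0" by (simp add: irr_char_id)
      hence "(\<Sum>\<tau>\<in>sym_grp n. form n (perm_act \<tau> e) (perm_act \<tau> e)) = 0"
        using c[OF id_sym_grp] cpos by simp
      hence "form n e e = 0" by (simp add: form_perm_act card_sym_grp)
      moreover have "form n e e = of_real (\<Sum>t\<in>tabloid_space n. (cmod (e t))\<^sup>2)"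
        by (rule form_self_real) (simp add: e_def polytabloid_real)
      moreover have "(\<Sum>t\<in>tabloid_space n. (cmod (e t))\<^sup>2) > 0"
        using tabloid_in_space[OF la T] polytabloid_at_tabloid[OF la T]
        by (intro sum_pos2[of _ "tabloid n T"]) (auto simp: e_def)
      ultimately show False by (metis of_real_eq_0_iff less_irrefl)
    qed
    thus ?thesis using main True by simp
  qed
qed

section \<open>Cycle types and completeness of the irreducible characters\<close>

text \<open>
  The model permutation for each shape: every row is rotated by one cell, so the cycle lengths are
  the row lengths.
\<close>

definition row_shift :: "nat list \<Rightarrow> nat \<times> nat \<Rightarrow> nat \<times> nat" where
  "row_shift la = (\<lambda>(i, j). (i, Suc j mod la ! i))"

lemma orbit_enumeration:
  assumes "x \<in> orbit f x" "finite (orbit f x)"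
  shows "bij_betw (\<lambda>j. (f ^^ j) x) {..<card (orbit f x)} (orbit f x)"
    and "(f ^^ card (orbit f x)) x = x"
proof -
  let ?d = "funpow_dist1 f x x"
  have o: "orbit f x = (\<lambda>j. (f ^^ j) x) ` {0..<?d}"
    by (rule orbit_conv_funpow_dist1[OF assms(1)])
  have i: "inj_on (\<lambda>j. (f ^^ j) x) {0..<?d}"
    by (rule inj_on_funpow_dist1[OF assms(1)])
  have d: "card (orbit f x) = ?d" by (subst o) (simp add: card_image[OF i])
  show "bij_betw (\<lambda>j. (f ^^ j) x) {..<card (orbit f x)} (orbit f x)"
    unfolding d using i o by (simp add: bij_betw_def atLeast0LessThan)
  show "(f ^^ card (orbit f x)) x = x"
    unfolding d by (rule funpow_dist1_prop[OF assms(1)])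
qed

text \<open>
  List the orbits by decreasing size and write each one as a row, in the order in which the
  permutation runs through it from a chosen starting point.
\<close>

lemma ex_cycle_tableau:
  assumes s: "\<sigma> \<in> sym_grp n"
  shows "\<exists>la\<in>partitions n. \<exists>T\<in>tableaux la. \<forall>x<n. T (\<sigma> x) = row_shift la (T x)"
proof -
  have p: "\<sigma> permutes {..<n}" using s by (simp add: sym_grp_def)
  have perm: "permutation \<sigma>" using p by (auto simp: permutation_permutes)
  have self: "x \<in> orbit \<sigma> x" for x by (rule permutation_self_in_orbit[OF perm])
  have sub: "orbit \<sigma> x \<subseteq> {..<n}" if "x < n" for x
    using permutes_orbit_subset[OF p] that by simp
  have fin: "finite (orbit \<sigma> x)" if "x < n" for x
    using sub[OF that] finite_subset by blast
  have same: "orbit \<sigma> y = orbit \<sigma> x" if "y \<in> orbit \<sigma> x" for x y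
    using that orbit_cyclic_eq3[of \<sigma> "orbit \<sigma> x" y] cyclic_on_orbit[OF p] by blast
  define Os where "Os = orbit \<sigma> ` {..<n}"
  obtain os0 where os0: "set os0 = Os" "distinct os0"
    using finite_distinct_list[of Os] by (auto simp: Os_def)
  define os where "os = rev (sort_key card os0)"
  have os: "set os = Os" "distinct os" using os0 by (simp_all add: os_def)
  have sorted: "sorted_wrt (\<ge>) (map card os)"
    by (simp add: os_def sorted_wrt_rev sorted_wrt_map flip: rev_map)
       (metis sorted_map sorted_sort_key)
  define la where "la = map card os"
  define rp where "rp i = (SOME x. x \<in> os ! i)" for i
  have rp: "rp i < n" "orbit \<sigma> (rp i) = os ! i" if "i < length os" for i
  proof -
    have "os ! i \<in> Os" using that os(1) nth_mem by blast
    then obtain x where x: "x < n" "os ! i = orbit \<sigma> x" by (auto simp: Os_def)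
    have "rp i \<in> os ! i" unfolding rp_def x(2) by (rule someI[of _ x]) (rule self)
    thus "rp i < n" "orbit \<sigma> (rp i) = os ! i"
      using x(2) sub[OF x(1)] same[of "rp i" x] by blast+
  qed
  have enum: "bij_betw (\<lambda>j. (\<sigma> ^^ j) (rp i)) {..<la ! i} (os ! i)" "(\<sigma> ^^ (la ! i)) (rp i) = rp i"
    if "i < length os" for i
    using orbit_enumeration[OF self fin[OF rp(1)[OF that]]] rp(2)[OF that] that
    by (simp_all add: la_def)
  have len: "length la = length os" by (simp add: la_def)
  have pos: "la ! i > 0" if "i < length os" for i
  proof -
    have "rp i \<in> os ! i" using self[of "rp i"] rp(2)[OF that] by simp
    moreover have "finite (os ! i)" using fin[OF rp(1)[OF that]] rp(2)[OF that] by simp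
    ultimately show ?thesis using that by (auto simp: la_def card_gt_0_iff)
  qed
  have Un: "\<Union> Os = {..<n}" using sub self by (auto simp: Os_def)
  have disj: "A \<inter> B = {}" if AB: "A \<in> Os" "B \<in> Os" "A \<noteq> B" for A B
  proof (rule ccontr)
    assume "A \<inter> B \<noteq> {}"
    then obtain z x y where "z \<in> orbit \<sigma> x" "z \<in> orbit \<sigma> y" "A = orbit \<sigma> x" "B = orbit \<sigma> y"
      using AB(1,2) unfolding Os_def by blast
    thus False using same[of z x] same[of z y] AB(3) by simp
  qed
  define pt where "pt = (\<lambda>(i, j). (\<sigma> ^^ j) (rp i))"
  have mem: "pt (i, j) \<in> os ! i" if "(i, j) \<in> cells la" for i j
    using that bij_betwE[OF enum(1)[of i]] by (auto simp: cells_def len pt_def)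
  have ptb: "bij_betw pt (cells la) {..<n}"
  proof (rule bij_betw_imageI)
    show "inj_on pt (cells la)"
    proof (rule inj_onI, clarify)
      fix i j i' j'
      assume c: "(i, j) \<in> cells la" "(i', j') \<in> cells la" and eq: "pt (i, j) = pt (i', j')"
      have l: "i < length os" "i' < length os" using c by (auto simp: cells_def len)
      have "os ! i \<inter> os ! i' \<noteq> {}" using mem[OF c(1)] mem[OF c(2)] eq by auto
      moreover have "os ! i \<in> Os" "os ! i' \<in> Os"
        using nth_mem[OF l(1)] nth_mem[OF l(2)] os(1) by simp_all
      ultimately have "os ! i = os ! i'" using disj by metis
      hence "i = i'" using nth_eq_iff_index_eq[OF os(2) l] by simp
      moreover have "j = j'"
        using inj_onD[OF bij_betw_imp_inj_on[OF enum(1)[OF l(1)]], of j j'] c eq \<open>i = i'\<close>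
        by (simp add: cells_def pt_def)
      ultimately show "i = i' \<and> j = j'" by simp
    qed
    show "pt ` cells la = {..<n}"
    proof
      show "pt ` cells la \<subseteq> {..<n}"
      proof clarify
        fix i j assume c: "(i, j) \<in> cells la"
        hence "i < length os" by (simp add: cells_def len)
        hence "os ! i \<in> Os" using os(1) nth_mem[of i os] by simp
        thus "pt (i, j) < n" using mem[OF c] Un by blast
      qed
      show "{..<n} \<subseteq> pt ` cells la"
      proof
        fix x assume "x \<in> {..<n}"
        then obtain A where "A \<in> Os" "x \<in> A" using Un by blast
        then obtain i where i: "i < length os" "x \<in> os ! i" using os(1) by (metis in_set_conv_nth)
        then obtain j where "j < la ! i" "x = (\<sigma> ^^ j) (rp i)"
          using bij_betw_imp_surj_on[OF enum(1)[OF i(1)]] by blast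
        thus "x \<in> pt ` cells la"
          using i(1) by (intro image_eqI[of _ _ "(i, j)"]) (auto simp: pt_def cells_def len)
      qed
    qed
  qed
  have "sum_list la = n"
    using bij_betw_same_card[OF ptb] by (simp add: card_cells)
  moreover have "0 \<notin> set la"
    using pos by (auto simp: in_set_conv_nth len)
  ultimately have la: "la \<in> partitions n"
    using sorted by (simp add: partitions_def la_def)
  define T where "T = inv_into (cells la) pt"
  have T: "T \<in> tableaux la"
    unfolding T_def tableaux_def using bij_betw_inv_into[OF ptb] \<open>sum_list la = n\<close> by simp
  have Tpt: "T (pt c) = c" if "c \<in> cells la" for c
    unfolding T_def by (rule bij_betw_inv_into_left[OF ptb that])
  have "T (\<sigma> x) = row_shift la (T x)" if "x < n" for x
  proof -
    have "x \<in> pt ` cells la" using that bij_betw_imp_surj_on[OF ptb] by simp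
    then obtain i j where c: "(i, j) \<in> cells la" "x = pt (i, j)" by (elim imageE) force
    have i: "i < length os" "j < la ! i" using c(1) by (simp_all add: cells_def len)
    have "\<sigma> x = pt (i, Suc j mod la ! i)"
    proof (cases "Suc j = la ! i")
      case True
      show ?thesis using enum(2)[OF i(1)] c(2) by (simp add: pt_def flip: True)
    next
      case False
      thus ?thesis using i c(2) by (simp add: pt_def)
    qed
    moreover have "(i, Suc j mod la ! i) \<in> cells la"
      using i(1) pos[OF i(1)] by (simp add: cells_def len)
    ultimately have "T (\<sigma> x) = (i, Suc j mod la ! i)" by (simp only: Tpt)
    moreover have "T x = (i, j)" unfolding c(2) by (rule Tpt[OF c(1)])
    ultimately show ?thesis by (simp only: row_shift_def prod.case)
  qed
  thus ?thesis by (intro bexI[OF _ la] bexI[OF _ T]) simp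
qed

text \<open>
  One shape on which the permutation becomes the row rotation. It is picked by choice, and its fibres
  lie in conjugacy classes by the lemma \<open>conjugate_of_cycle_type_eq\<close> below.
\<close>

definition cycle_type :: "nat \<Rightarrow> (nat \<Rightarrow> nat) \<Rightarrow> nat list" where
  "cycle_type n \<sigma> = (SOME la. la \<in> partitions n \<and> (\<exists>T\<in>tableaux la. \<forall>x<n. T (\<sigma> x) = row_shift la (T x)))"

lemma cycle_type:
  assumes "\<sigma> \<in> sym_grp n"
  shows "cycle_type n \<sigma> \<in> partitions n"
    and "\<exists>T\<in>tableaux (cycle_type n \<sigma>). \<forall>x<n. T (\<sigma> x) = row_shift (cycle_type n \<sigma>) (T x)"
proof -
  have "\<exists>la. la \<in> partitions n \<and> (\<exists>T\<in>tableaux la. \<forall>x<n. T (\<sigma> x) = row_shift la (T x))"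
    using ex_cycle_tableau[OF assms] by blast
  from someI_ex[OF this] show "cycle_type n \<sigma> \<in> partitions n"
    and "\<exists>T\<in>tableaux (cycle_type n \<sigma>). \<forall>x<n. T (\<sigma> x) = row_shift (cycle_type n \<sigma>) (T x)"
    unfolding cycle_type_def by blast+
qed

lemma conjugate_of_cycle_type_eq:
  assumes s: "\<sigma> \<in> sym_grp n" and t: "\<tau> \<in> sym_grp n" and eq: "cycle_type n \<sigma> = cycle_type n \<tau>"
  shows "\<exists>\<rho>\<in>sym_grp n. \<tau> = inv \<rho> \<circ> \<sigma> \<circ> \<rho>"
proof -
  define la where "la = cycle_type n \<sigma>"
  have la: "la \<in> partitions n" unfolding la_def by (rule cycle_type(1)[OF s])
  obtain T where T: "T \<in> tableaux la" "\<And>x. x < n \<Longrightarrow> T (\<sigma> x) = row_shift la (T x)"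
    using cycle_type(2)[OF s] unfolding la_def by blast
  obtain S where S: "S \<in> tableaux la" "\<And>x. x < n \<Longrightarrow> S (\<tau> x) = row_shift la (S x)"
    using cycle_type(2)[OF t] unfolding la_def eq by blast
  obtain \<rho> where r: "\<rho> permutes {..<n}" "\<And>x. x < n \<Longrightarrow> T (\<rho> x) = S x"
    using tableaux_transitive[OF la T(1) S(1)] by blast
  have rs: "\<rho> \<in> sym_grp n" using r by (simp add: sym_grp_def)
  have inj: "inj_on T {..<n}" using tableaux_bij[OF T(1) la] by (simp add: bij_betw_def)
  have "\<rho> (\<tau> x) = \<sigma> (\<rho> x)" for x
  proof (cases "x < n")
    case True
    have l: "\<tau> x < n" "\<rho> x < n" "\<rho> (\<tau> x) < n" "\<sigma> (\<rho> x) < n"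
      using sym_grp_less[OF t] sym_grp_less[OF rs] sym_grp_less[OF s] True by auto
    have "T (\<rho> (\<tau> x)) = T (\<sigma> (\<rho> x))"
      using l True by (simp add: r(2) S(2) T(2))
    thus ?thesis using inj_onD[OF inj] l by simp
  next
    case False
    have "\<tau> x = x" "\<rho> x = x" "\<sigma> x = x"
      using s t rs False permutes_not_in[of _ "{..<n}" x] by (auto simp: sym_grp_def)
    thus ?thesis by simp
  qed
  hence "\<rho> \<circ> \<tau> = \<sigma> \<circ> \<rho>" by (simp add: fun_eq_iff)
  hence "inv \<rho> \<circ> (\<rho> \<circ> \<tau>) = inv \<rho> \<circ> \<sigma> \<circ> \<rho>" by (simp add: comp_assoc)
  hence "\<tau> = inv \<rho> \<circ> \<sigma> \<circ> \<rho>"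
    by (simp add: inv_comp_sym_grp[OF rs] flip: comp_assoc)
  thus ?thesis using rs by blast
qed

text \<open>
  Characters cut off outside the group, as elements of the vector space of all functions on
  permutations; values outside the group would interfere with linear independence and spans.
\<close>

definition char_on_group :: "nat \<Rightarrow> nat list \<Rightarrow> (nat \<Rightarrow> nat) \<Rightarrow> complex" where
  "char_on_group n la = (\<lambda>\<sigma>. if \<sigma> \<in> sym_grp n then irr_char la \<sigma> else 0)"

lemma char_coefficient:
  assumes "mu \<in> partitions n"
    and "\<And>\<sigma>. \<sigma> \<in> sym_grp n \<Longrightarrow> \<phi> \<sigma> = (\<Sum>la\<in>partitions n. g la * irr_char la \<sigma>)"
  shows "(\<Sum>\<sigma>\<in>sym_grp n. \<phi> \<sigma> * irr_char mu \<sigma>) = fact n * g mu"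
proof -
  have "(\<Sum>\<sigma>\<in>sym_grp n. \<phi> \<sigma> * irr_char mu \<sigma>)
      = (\<Sum>\<sigma>\<in>sym_grp n. \<Sum>la\<in>partitions n. g la * (irr_char la \<sigma> * irr_char mu \<sigma>))"
    using assms(2) by (intro sum.cong refl) (simp add: sum_distrib_right mult.assoc)
  also have "\<dots> = (\<Sum>la\<in>partitions n. g la * (\<Sum>\<sigma>\<in>sym_grp n. irr_char la \<sigma> * irr_char mu \<sigma>))"
    by (subst sum.swap) (simp add: sum_distrib_left)
  also have "\<dots> = (\<Sum>la\<in>partitions n. if la = mu then g la * fact n else 0)"
    using assms(1) by (intro sum.cong refl) (simp add: irr_char_orthonormal)
  also have "\<dots> = fact n * g mu"
    using assms(1) by (simp add: sum.delta)
  finally show ?thesis .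
qed

lemma inj_on_char_on_group: "inj_on (char_on_group n) (partitions n)"
proof (rule inj_onI, rule ccontr)
  fix la mu assume h: "la \<in> partitions n" "mu \<in> partitions n"
    "char_on_group n la = char_on_group n mu" "la \<noteq> mu"
  have "irr_char la \<sigma> = irr_char mu \<sigma>" if "\<sigma> \<in> sym_grp n" for \<sigma>
    using fun_cong[OF h(3), of \<sigma>] that by (simp add: char_on_group_def)
  hence "(\<Sum>\<sigma>\<in>sym_grp n. irr_char la \<sigma> * irr_char mu \<sigma>) = (\<Sum>\<sigma>\<in>sym_grp n. irr_char mu \<sigma> * irr_char mu \<sigma>)"
    by simp
  thus False using irr_char_orthonormal h by simp
qed

lemma independent_chars: "cfun.independent (char_on_group n ` partitions n)"
proof (rule cfun.independent_if_scalars_zero)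
  fix f x
  assume z: "(\<Sum>x\<in>char_on_group n ` partitions n. cscale (f x) x) = 0"
    and x: "x \<in> char_on_group n ` partitions n"
  obtain mu where mu: "mu \<in> partitions n" "x = char_on_group n mu" using x by blast
  have "(\<Sum>la\<in>partitions n. cscale (f (char_on_group n la)) (char_on_group n la)) = 0"
    using z by (simp add: sum.reindex[OF inj_on_char_on_group])
  hence z': "(\<Sum>la\<in>partitions n. cscale (f (char_on_group n la)) (char_on_group n la) \<sigma>) = 0" for \<sigma>
    unfolding sum_fun_eq[symmetric] by (simp add: fun_eq_iff)
  have "0 = (\<Sum>la\<in>partitions n. f (char_on_group n la) * irr_char la \<sigma>)" if "\<sigma> \<in> sym_grp n" for \<sigma>
    using z'[of \<sigma>] that by (simp add: cscale_def char_on_group_def)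
  from char_coefficient[OF mu(1) this] show "f x = 0" using mu by simp
qed simp

text \<open>
  Class functions lie in the span of the indicators of the fibres of the cycle type, and there are
  only as many fibres as partitions. The characters are equally many, lie in this span and are
  linearly independent, so one more independent class function cannot exist.
\<close>

lemma class_function_expansion:
  assumes class_fun: "\<And>\<sigma> \<rho>. \<sigma> \<in> sym_grp n \<Longrightarrow> \<rho> \<in> sym_grp n \<Longrightarrow> \<phi> (inv \<rho> \<circ> \<sigma> \<circ> \<rho>) = \<phi> \<sigma>"
  shows "\<exists>g. \<forall>\<sigma>\<in>sym_grp n. \<phi> \<sigma> = (\<Sum>la\<in>partitions n. g la * irr_char la \<sigma>)"
proof -
  define ind where "ind la = (\<lambda>\<sigma>. if \<sigma> \<in> sym_grp n \<and> cycle_type n \<sigma> = la then 1 else 0 :: complex)" for la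
  have in_span: "(\<lambda>\<sigma>. if \<sigma> \<in> sym_grp n then \<psi> \<sigma> else 0) \<in> cfun.span (ind ` partitions n)"
    if psi: "\<And>\<sigma> \<rho>. \<sigma> \<in> sym_grp n \<Longrightarrow> \<rho> \<in> sym_grp n \<Longrightarrow> \<psi> (inv \<rho> \<circ> \<sigma> \<circ> \<rho>) = \<psi> \<sigma>" for \<psi>
  proof -
    define c where "c la = \<psi> (SOME \<sigma>. \<sigma> \<in> sym_grp n \<and> cycle_type n \<sigma> = la)" for la
    have c: "c (cycle_type n \<sigma>) = \<psi> \<sigma>" if s: "\<sigma> \<in> sym_grp n" for \<sigma>
    proof -
      define \<tau> where "\<tau> = (SOME \<tau>. \<tau> \<in> sym_grp n \<and> cycle_type n \<tau> = cycle_type n \<sigma>)"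
      have t: "\<tau> \<in> sym_grp n \<and> cycle_type n \<tau> = cycle_type n \<sigma>"
        unfolding \<tau>_def by (rule someI[of _ \<sigma>]) (simp add: s)
      then obtain \<rho> where "\<rho> \<in> sym_grp n" "\<tau> = inv \<rho> \<circ> \<sigma> \<circ> \<rho>"
        using conjugate_of_cycle_type_eq[OF s] by metis
      thus ?thesis using psi[OF s] by (simp add: c_def flip: \<tau>_def)
    qed
    have "(\<lambda>\<sigma>. if \<sigma> \<in> sym_grp n then \<psi> \<sigma> else 0) = (\<lambda>\<sigma>. \<Sum>la\<in>partitions n. cscale (c la) (ind la) \<sigma>)"
    proof
      fix \<sigma>
      show "(if \<sigma> \<in> sym_grp n then \<psi> \<sigma> else 0) = (\<Sum>la\<in>partitions n. cscale (c la) (ind la) \<sigma>)"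
      proof (cases "\<sigma> \<in> sym_grp n")
        case True
        have "(\<Sum>la\<in>partitions n. cscale (c la) (ind la) \<sigma>)
            = (\<Sum>la\<in>partitions n. if cycle_type n \<sigma> = la then c la else 0)"
          using True by (intro sum.cong refl) (simp add: cscale_def ind_def)
        also have "\<dots> = \<psi> \<sigma>"
          using cycle_type(1)[OF True] c[OF True] by (simp add: sum.delta')
        finally show ?thesis using True by simp
      qed (simp add: cscale_def ind_def)
    qed
    also have "\<dots> = (\<Sum>la\<in>partitions n. cscale (c la) (ind la))" by (rule sum_fun_eq)
    also have "\<dots> \<in> cfun.span (ind ` partitions n)"
      by (intro cfun.span_sum cfun.span_scale cfun.span_base) auto
    finally show ?thesis .
  qed
  define B where "B = char_on_group n ` partitions n"
  have finB: "finite B" by (simp add: B_def)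
  have cardB: "card B = card (partitions n)"
    unfolding B_def by (rule card_image[OF inj_on_char_on_group])
  have B_sub: "B \<subseteq> cfun.span (ind ` partitions n)"
    unfolding B_def char_on_group_def using irr_char_conj by (auto intro!: in_span)
  define \<phi>' where "\<phi>' = (\<lambda>\<sigma>. if \<sigma> \<in> sym_grp n then \<phi> \<sigma> else 0)"
  have phi: "\<phi>' \<in> cfun.span B"
  proof (rule ccontr)
    assume no: "\<phi>' \<notin> cfun.span B"
    hence ind: "cfun.independent (insert \<phi>' B)"
      using independent_chars cfun.independent_insertI unfolding B_def by blast
    have "insert \<phi>' B \<subseteq> cfun.span (ind ` partitions n)"
      using B_sub in_span[of \<phi>] class_fun by (simp add: \<phi>'_def)
    hence "card (insert \<phi>' B) \<le> card (ind ` partitions n)"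
      using cfun.independent_span_bound[OF _ ind] by simp
    also have "\<dots> \<le> card (partitions n)" by (rule card_image_le) simp
    finally have "card (insert \<phi>' B) \<le> card B" using cardB by simp
    moreover have "\<phi>' \<notin> B" using no cfun.span_base by blast
    ultimately show False using finB by simp
  qed
  let ?r = "cfun.representation B \<phi>'"
  have "(\<Sum>b\<in>B. cscale (?r b) b) = \<phi>'"
    using cfun.sum_representation_eq[OF _ phi finB order_refl] independent_chars by (simp add: B_def)
  hence "\<phi>' = (\<Sum>la\<in>partitions n. cscale (?r (char_on_group n la)) (char_on_group n la))"
    unfolding B_def by (simp add: sum.reindex[OF inj_on_char_on_group])
  hence e: "\<phi>' = (\<lambda>\<sigma>. \<Sum>la\<in>partitions n. cscale (?r (char_on_group n la)) (char_on_group n la) \<sigma>)"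
    by (simp only: sum_fun_eq)
  have "\<phi> \<sigma> = (\<Sum>la\<in>partitions n. ?r (char_on_group n la) * irr_char la \<sigma>)" if "\<sigma> \<in> sym_grp n" for \<sigma>
    using fun_cong[OF e, of \<sigma>] that by (simp add: \<phi>'_def cscale_def char_on_group_def)
  thus ?thesis by (intro exI[of _ "\<lambda>la. ?r (char_on_group n la)"]) blast
qed

section \<open>Kronecker coefficients\<close>

lemma sum_cmod_irr_char_square:
  assumes la: "la \<in> partitions n"
  shows "(\<Sum>\<sigma>\<in>sym_grp n. (cmod (irr_char la \<sigma>))\<^sup>2) = fact n"
proof -
  have "irr_char la \<sigma> * irr_char la \<sigma> = of_real ((cmod (irr_char la \<sigma>))\<^sup>2)" if "\<sigma> \<in> sym_grp n" for \<sigma>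
    using irr_char_real[OF la that]
    by (auto elim!: Reals_cases simp: power2_eq_square norm_mult simp flip: of_real_mult)
  hence "complex_of_real (\<Sum>\<sigma>\<in>sym_grp n. (cmod (irr_char la \<sigma>))\<^sup>2)
      = (\<Sum>\<sigma>\<in>sym_grp n. irr_char la \<sigma> * irr_char la \<sigma>)"
    by simp
  also have "\<dots> = complex_of_real (fact n)" using irr_char_orthonormal[OF la la] by simp
  finally show ?thesis by (simp only: of_real_eq_iff)
qed

lemma char_dim_le_sqrt_fact:
  assumes la: "la \<in> partitions n"
  shows "real (char_dim la) \<le> sqrt (fact n)"
proof (rule real_le_rsqrt)
  have "(real (char_dim la))\<^sup>2 = (cmod (irr_char la id))\<^sup>2" by (simp add: irr_char_id)
  also have "\<dots> \<le> (\<Sum>\<sigma>\<in>sym_grp n. (cmod (irr_char la \<sigma>))\<^sup>2)"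
    by (rule member_le_sum[OF id_sym_grp]) auto
  finally show "(real (char_dim la))\<^sup>2 \<le> fact n" by (simp only: sum_cmod_irr_char_square[OF la])
qed

lemma char_dim_pos:
  assumes la: "la \<in> partitions n"
  shows "char_dim la > 0"
proof (rule ccontr)
  assume "\<not> char_dim la > 0"
  hence "cmod (irr_char la \<sigma>) = 0" if "\<sigma> \<in> sym_grp n" for \<sigma>
    using cmod_irr_char_le_dim[OF la that] by simp
  hence "(\<Sum>\<sigma>\<in>sym_grp n. (cmod (irr_char la \<sigma>))\<^sup>2) = 0" by simp
  thus False by (simp only: sum_cmod_irr_char_square[OF la] fact_nonzero)
qed

text \<open>
  The defining property of the coefficients determines them: existence is the expansion of the class
  function given by the product, whose coefficients are real because they are averages of products
  of real characters, and uniqueness is orthonormality.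
\<close>

lemma kronecker_characterization:
  assumes mu: "mu \<in> partitions n" and nu: "nu \<in> partitions n"
  shows "\<exists>g. (\<forall>ka\<in>partitions n. kronecker ka mu nu = g ka) \<and>
    (\<forall>\<sigma>\<in>sym_grp n. irr_char mu \<sigma> * irr_char nu \<sigma> = (\<Sum>ka\<in>partitions n. of_real (g ka) * irr_char ka \<sigma>))"
proof -
  obtain h where h: "\<And>\<sigma>. \<sigma> \<in> sym_grp n \<Longrightarrow>
      irr_char mu \<sigma> * irr_char nu \<sigma> = (\<Sum>ka\<in>partitions n. h ka * irr_char ka \<sigma>)"
    using class_function_expansion[of n "\<lambda>\<sigma>. irr_char mu \<sigma> * irr_char nu \<sigma>"]
      irr_char_conj[OF mu] irr_char_conj[OF nu] by auto
  have h_real: "h ka \<in> \<real>" if ka: "ka \<in> partitions n" for ka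
  proof -
    have "(\<Sum>\<sigma>\<in>sym_grp n. irr_char mu \<sigma> * irr_char nu \<sigma> * irr_char ka \<sigma>) = fact n * h ka"
      by (rule char_coefficient[OF ka]) (rule h)
    moreover have "(\<Sum>\<sigma>\<in>sym_grp n. irr_char mu \<sigma> * irr_char nu \<sigma> * irr_char ka \<sigma>) \<in> \<real>"
      by (intro sum_in_Reals Reals_mult irr_char_real[OF mu] irr_char_real[OF nu] irr_char_real[OF ka])
    ultimately have "fact n * h ka \<in> \<real>" by simp
    moreover have "(fact n :: complex) \<in> \<real>" by (metis Reals_of_nat of_nat_fact)
    ultimately have "fact n * h ka / fact n \<in> \<real>" by (rule Reals_divide)
    thus ?thesis by simp
  qed
  define g where "g ka = (if ka \<in> partitions n then Re (h ka) else 0)" for ka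
  have g: "irr_char mu \<sigma> * irr_char nu \<sigma> = (\<Sum>ka\<in>partitions n. of_real (g ka) * irr_char ka \<sigma>)"
    if "\<sigma> \<in> sym_grp n" for \<sigma>
    unfolding h[OF that] by (intro sum.cong refl) (simp add: g_def h_real)
  have zero: "\<forall>ka. ka \<notin> partitions n \<longrightarrow> g ka = 0" by (simp add: g_def)
  have unique: "g' = g" if zero': "\<forall>ka. ka \<notin> partitions n \<longrightarrow> g' ka = 0"
    and g': "\<forall>\<sigma>\<in>sym_grp n. irr_char mu \<sigma> * irr_char nu \<sigma> = (\<Sum>ka\<in>partitions n. of_real (g' ka) * irr_char ka \<sigma>)"
    for g'
  proof
    fix ka
    show "g' ka = g ka"
    proof (cases "ka \<in> partitions n")
      case True
      let ?s = "\<Sum>\<sigma>\<in>sym_grp n. irr_char mu \<sigma> * irr_char nu \<sigma> * irr_char ka \<sigma>"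
      have "?s = fact n * complex_of_real (g' ka)"
        by (rule char_coefficient[OF True]) (rule bspec[OF g'])
      moreover have "?s = fact n * complex_of_real (g ka)"
        by (rule char_coefficient[OF True]) (rule g)
      ultimately show ?thesis by simp
    next
      case False
      thus ?thesis using zero zero' by metis
    qed
  qed
  have "(THE g. (\<forall>ka. ka \<notin> partitions n \<longrightarrow> g ka = 0) \<and> (\<forall>\<sigma>\<in>sym_grp n.
      irr_char mu \<sigma> * irr_char nu \<sigma> = (\<Sum>ka\<in>partitions n. of_real (g ka) * irr_char ka \<sigma>))) = g"
  proof (rule the_equality)
    show "(\<forall>ka. ka \<notin> partitions n \<longrightarrow> g ka = 0) \<and> (\<forall>\<sigma>\<in>sym_grp n.
      irr_char mu \<sigma> * irr_char nu \<sigma> = (\<Sum>ka\<in>partitions n. of_real (g ka) * irr_char ka \<sigma>))"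
      by (intro conjI zero ballI g)
  qed (elim conjE, rule unique)
  hence "kronecker ka mu nu = g ka" if "ka \<in> partitions n" for ka
    unfolding kronecker_def Let_def sum_list_partition[OF that] by (rule fun_cong)
  moreover have "\<forall>\<sigma>\<in>sym_grp n. irr_char mu \<sigma> * irr_char nu \<sigma>
      = (\<Sum>ka\<in>partitions n. of_real (g ka) * irr_char ka \<sigma>)"
    by (intro ballI g)
  ultimately show ?thesis by (intro exI[of _ g]) simp
qed

lemma irr_char_product:
  assumes "mu \<in> partitions n" "nu \<in> partitions n" "\<sigma> \<in> sym_grp n"
  shows "irr_char mu \<sigma> * irr_char nu \<sigma>
       = (\<Sum>ka\<in>partitions n. of_real (kronecker ka mu nu) * irr_char ka \<sigma>)"
proof -
  obtain g where g: "\<forall>ka\<in>partitions n. kronecker ka mu nu = g ka"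
    and e: "\<forall>\<sigma>\<in>sym_grp n. irr_char mu \<sigma> * irr_char nu \<sigma> = (\<Sum>ka\<in>partitions n. of_real (g ka) * irr_char ka \<sigma>)"
    using kronecker_characterization[OF assms(1,2)] by blast
  show ?thesis
    unfolding bspec[OF e assms(3)] by (intro sum.cong refl) (simp add: g)
qed

lemma kronecker_eq_sum:
  assumes "la \<in> partitions n" "mu \<in> partitions n" "nu \<in> partitions n"
  shows "fact n * complex_of_real (kronecker la mu nu)
       = (\<Sum>\<sigma>\<in>sym_grp n. irr_char la \<sigma> * irr_char mu \<sigma> * irr_char nu \<sigma>)"
  using char_coefficient[OF assms(1) irr_char_product[OF assms(2,3)]] by (simp add: mult_ac)

lemma kronecker_symmetric:
  assumes "la \<in> partitions n" "mu \<in> partitions n" "nu \<in> partitions n"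
  shows "kronecker la mu nu = kronecker mu la nu" "kronecker la mu nu = kronecker nu la mu"
proof -
  have "fact n * complex_of_real (kronecker la mu nu) = fact n * complex_of_real (kronecker mu la nu)"
    unfolding kronecker_eq_sum[OF assms] kronecker_eq_sum[OF assms(2,1,3)] by (simp add: mult_ac)
  thus "kronecker la mu nu = kronecker mu la nu" by simp
  have "fact n * complex_of_real (kronecker la mu nu) = fact n * complex_of_real (kronecker nu la mu)"
    unfolding kronecker_eq_sum[OF assms] kronecker_eq_sum[OF assms(3,1,2)] by (simp add: mult_ac)
  thus "kronecker la mu nu = kronecker nu la mu" by simp
qed

text \<open>
  Bound one character by its dimension; the average of the product of the other two is at most one,
  as both have norm one.
\<close>

lemma kronecker_le_char_dim:
  assumes la: "la \<in> partitions n" and mu: "mu \<in> partitions n" and nu: "nu \<in> partitions n"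
  shows "kronecker la mu nu \<le> real (char_dim la)"
proof -
  have am_gm: "x * y \<le> (x\<^sup>2 + y\<^sup>2) / 2" for x y :: real
    using sum_squares_bound[of x y] by simp
  let ?f = "real (char_dim la)"
  have "fact n * \<bar>kronecker la mu nu\<bar> = cmod (\<Sum>\<sigma>\<in>sym_grp n. irr_char la \<sigma> * irr_char mu \<sigma> * irr_char nu \<sigma>)"
    unfolding kronecker_eq_sum[OF assms, symmetric] by (simp add: norm_mult)
  also have "\<dots> \<le> (\<Sum>\<sigma>\<in>sym_grp n. cmod (irr_char la \<sigma>) * (cmod (irr_char mu \<sigma>) * cmod (irr_char nu \<sigma>)))"
    by (rule order_trans[OF norm_sum]) (simp add: norm_mult mult.assoc)
  also have "\<dots> \<le> (\<Sum>\<sigma>\<in>sym_grp n. ?f * (((cmod (irr_char mu \<sigma>))\<^sup>2 + (cmod (irr_char nu \<sigma>))\<^sup>2) / 2))"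
    by (intro sum_mono mult_mono cmod_irr_char_le_dim[OF la] am_gm) auto
  also have "\<dots> = ?f * (((\<Sum>\<sigma>\<in>sym_grp n. (cmod (irr_char mu \<sigma>))\<^sup>2) + (\<Sum>\<sigma>\<in>sym_grp n. (cmod (irr_char nu \<sigma>))\<^sup>2)) / 2)"
    by (simp only: sum_distrib_left[symmetric] sum_divide_distrib[symmetric] sum.distrib)
  also have "\<dots> = ?f * fact n"
    unfolding sum_cmod_irr_char_square[OF mu] sum_cmod_irr_char_square[OF nu] by simp
  finally have "\<bar>kronecker la mu nu\<bar> \<le> ?f" by (simp add: mult.commute)
  thus ?thesis by simp
qed

text \<open>
  The expansion of the product of characters, evaluated at the identity.
\<close>

lemma char_dim_product:
  assumes "la \<in> partitions n" "mu \<in> partitions n"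
  shows "real (char_dim la) * real (char_dim mu)
       = (\<Sum>nu\<in>partitions n. kronecker la mu nu * real (char_dim nu))"
proof -
  have "complex_of_real (real (char_dim la) * real (char_dim mu))
      = complex_of_real (\<Sum>nu\<in>partitions n. kronecker nu la mu * real (char_dim nu))"
    using irr_char_product[OF assms id_sym_grp] by (simp add: irr_char_id)
  hence "real (char_dim la) * real (char_dim mu) = (\<Sum>nu\<in>partitions n. kronecker nu la mu * real (char_dim nu))"
    by (simp only: of_real_eq_iff)
  thus ?thesis using kronecker_symmetric(2)[OF assms] by simp
qed


section \<open>The number of partitions\<close>

definition partitions_le :: "nat \<Rightarrow> nat \<Rightarrow> nat list set" where
  "partitions_le K n = {la \<in> partitions n. set la \<subseteq> {..K}}"

lemma finite_partitions_le [simp]: "finite (partitions_le K n)"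
  by (simp add: partitions_le_def)

lemma partitions_le_0: "partitions_le 0 n \<subseteq> {[]}"
proof
  fix la assume "la \<in> partitions_le 0 n"
  hence "0 \<notin> set la" "set la \<subseteq> {0}" by (auto simp: partitions_le_def partitions_def)
  thus "la \<in> {[]}" by (cases la) auto
qed

text \<open>
  A partition with a part of size \<open>Suc K\<close> has it as its first part, and removing it leaves a
  partition with the same bound on the parts.
\<close>

lemma partitions_le_Suc:
  "partitions_le (Suc K) n \<subseteq> partitions_le K n \<union>
     (if Suc K \<le> n then (#) (Suc K) ` partitions_le (Suc K) (n - Suc K) else {})"
proof
  fix la assume la: "la \<in> partitions_le (Suc K) n"
  show "la \<in> partitions_le K n \<union>
     (if Suc K \<le> n then (#) (Suc K) ` partitions_le (Suc K) (n - Suc K) else {})"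
  proof (cases "Suc K \<in> set la")
    case False
    hence "set la \<subseteq> {..K}" using la by (force simp: partitions_le_def le_Suc_eq)
    thus ?thesis using la by (simp add: partitions_le_def)
  next
    case True
    then obtain x xs where xs: "la = x # xs" by (cases la) auto
    have x: "x = Suc K"
      using la True by (auto simp: xs partitions_le_def partitions_def)
    have "Suc K + sum_list xs = n" "xs \<in> partitions_le (Suc K) (sum_list xs)"
      using la by (auto simp: xs x partitions_le_def partitions_def)
    thus ?thesis by (auto simp: xs x)
  qed
qed

text \<open>
  The product is the generating function of the partitions with parts at most \<open>K\<close>, evaluated at
  \<open>x = exp (- t)\<close>, and a single term of a series with nonnegative terms is at most its sum. The induction
  uses the recursion of the coefficients: with \<open>G\<close> the product up to \<open>Suc K\<close> and \<open>q\<close> the value of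
  \<open>x ^ Suc K\<close>, the two kinds of partitions contribute at most \<open>G (1 - q)\<close> and \<open>G q\<close>.
\<close>

lemma card_partitions_le_exp_bound:
  fixes t :: real
  assumes t: "t > 0"
  shows "real (card (partitions_le K n)) * exp (- t * real n) \<le> (\<Prod>k=1..K. 1 / (1 - exp (- t * real k)))"
proof (induction K arbitrary: n)
  case 0
  have "card (partitions_le 0 n) \<le> card {[] :: nat list}"
    by (rule card_mono[OF _ partitions_le_0]) simp
  hence "real (card (partitions_le 0 n)) * exp (- t * real n) \<le> 1 * 1"
    by (intro mult_mono) (use t in auto)
  thus ?case by simp
next
  case (Suc K)
  define G where "G = (\<Prod>k=1..Suc K. 1 / (1 - exp (- t * real k)))"
  define q where "q = exp (- t * real (Suc K))"
  have q: "0 < q" "q < 1" using t by (simp_all add: q_def)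
  have "G = (\<Prod>k=1..K. 1 / (1 - exp (- t * real k))) * (1 / (1 - q))"
    by (simp add: G_def q_def)
  hence GK: "(\<Prod>k=1..K. 1 / (1 - exp (- t * real k))) = G * (1 - q)"
    using q by simp
  have G: "G \<ge> 0" unfolding G_def using t by (intro prod_nonneg) auto
  show ?case
    unfolding G_def[symmetric]
  proof (induction n rule: less_induct)
    case (less n)
    have IH: "real (card (partitions_le K n)) * exp (- t * real n) \<le> G * (1 - q)"
      using Suc.IH[of n] by (simp only: GK)
    show ?case
    proof (cases "Suc K \<le> n")
      case True
      have "card (partitions_le (Suc K) n)
          \<le> card (partitions_le K n \<union> (#) (Suc K) ` partitions_le (Suc K) (n - Suc K))"
        by (rule card_mono) (use partitions_le_Suc[of K n] True in auto)
      also have "\<dots> \<le> card (partitions_le K n) + card ((#) (Suc K) ` partitions_le (Suc K) (n - Suc K))"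
        by (rule card_Un_le)
      also have "card ((#) (Suc K) ` partitions_le (Suc K) (n - Suc K)) \<le> card (partitions_le (Suc K) (n - Suc K))"
        by (rule card_image_le) simp
      finally have "real (card (partitions_le (Suc K) n))
          \<le> real (card (partitions_le K n)) + real (card (partitions_le (Suc K) (n - Suc K)))"
        by simp
      hence "real (card (partitions_le (Suc K) n)) * exp (- t * real n)
          \<le> (real (card (partitions_le K n)) + real (card (partitions_le (Suc K) (n - Suc K)))) * exp (- t * real n)"
        by (rule mult_right_mono) simp
      also have "\<dots> = real (card (partitions_le K n)) * exp (- t * real n)
          + (real (card (partitions_le (Suc K) (n - Suc K))) * exp (- t * real (n - Suc K))) * q"
        using True by (simp add: q_def distrib_right algebra_simps of_nat_diff flip: exp_add)
      also have "\<dots> \<le> G * (1 - q) + G * q"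
        using IH less.IH[of "n - Suc K"] True q by (intro add_mono mult_right_mono) auto
      finally show ?thesis by (simp add: algebra_simps)
    next
      case False
      have "card (partitions_le (Suc K) n) \<le> card (partitions_le K n)"
        by (rule card_mono) (use partitions_le_Suc[of K n] False in auto)
      hence "real (card (partitions_le (Suc K) n)) * exp (- t * real n)
          \<le> real (card (partitions_le K n)) * exp (- t * real n)"
        by (intro mult_right_mono) auto
      also have "\<dots> \<le> G * (1 - q)" by (rule IH)
      also have "\<dots> \<le> G * 1" using G q by (intro mult_left_mono) auto
      finally show ?thesis by simp
    qed
  qed
qed

lemma minus_ln_one_minus_sums:
  fixes y :: real
  assumes "0 \<le> y" "y < 1"
  shows "(\<lambda>m. y ^ Suc m / real (Suc m)) sums (- ln (1 - y))"
proof -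
  have "(\<lambda>m. - (y ^ m) / real m) sums ln (1 - y)"
    using ln_series'[of "- y"] assms by simp
  from sums_minus[OF this] have "(\<lambda>m. y ^ m / real m) sums (- ln (1 - y))" by simp
  thus ?thesis by (subst sums_Suc_iff) simp
qed

text \<open>
  Expand each logarithm as a power series and sum over \<open>k\<close> first. The term of index \<open>m\<close> becomes a
  geometric series bounded by \<open>1 / (t m)\<close>, which with the coefficient \<open>1 / m\<close> leaves the convergent sum
  of inverse squares.
\<close>

lemma log_euler_product_bound:
  fixes t :: real
  assumes t: "t > 0"
  shows "(\<Sum>k=1..K. - ln (1 - exp (- t * real k))) \<le> pi\<^sup>2 / 6 / t"
proof (rule sums_le)
  show "(\<lambda>m. \<Sum>k=1..K. exp (- t * real k) ^ Suc m / real (Suc m)) sums (\<Sum>k=1..K. - ln (1 - exp (- t * real k)))"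
    by (intro sums_sum minus_ln_one_minus_sums) (use t in auto)
  show "(\<lambda>m. 1 / (real m + 1)\<^sup>2 / t) sums (pi\<^sup>2 / 6 / t)"
    by (intro sums_divide) (use inverse_squares_sums in \<open>simp add: add_ac\<close>)
  fix m
  define z where "z = exp (- t * real (Suc m))"
  have z: "0 < z" "z < 1" using t by (simp_all add: z_def)
  have "exp (- t * real k) ^ Suc m = z ^ k" for k
    by (simp only: z_def exp_of_nat_mult[symmetric]) (simp add: mult_ac)
  hence eq: "(\<Sum>k=1..K. exp (- t * real k) ^ Suc m / real (Suc m)) = (\<Sum>k=1..K. z ^ k) / real (Suc m)"
    by (simp add: sum_divide_distrib del: power_Suc)
  have "(\<Sum>k=1..K. z ^ k) \<le> z / (1 - z)"
  proof -
    have "(1 - z) * (\<Sum>k=1..K. z ^ k) = z - z ^ Suc K"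
    proof (induction K)
      case (Suc K)
      have "(1 - z) * (\<Sum>k=1..Suc K. z ^ k) = (1 - z) * (\<Sum>k=1..K. z ^ k) + (1 - z) * z ^ Suc K"
        by (simp add: distrib_left)
      also have "(1 - z) * (\<Sum>k=1..K. z ^ k) = z - z ^ Suc K" by (rule Suc.IH)
      also have "z - z ^ Suc K + (1 - z) * z ^ Suc K = z - z ^ Suc (Suc K)"
        by (simp add: algebra_simps)
      finally show ?case .
    qed simp
    also have "\<dots> \<le> z" using z by simp
    finally show ?thesis using z by (simp add: field_simps)
  qed
  also have "z / (1 - z) = 1 / (exp (t * real (Suc m)) - 1)"
  proof -
    have "exp (t * real (Suc m)) = inverse z"
      unfolding z_def minus_mult_left[symmetric] exp_minus by simp
    thus ?thesis using z by (simp only:) (simp add: field_simps)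
  qed
  also have "\<dots> \<le> 1 / (t * real (Suc m))"
  proof -
    have "1 / (exp x - 1) \<le> 1 / x" if "x > 0" for x :: real
    proof -
      have "x \<le> exp x - 1" using exp_ge_add_one_self[of x] by linarith
      thus ?thesis using that by (intro divide_left_mono mult_pos_pos) auto
    qed
    thus ?thesis using t by simp
  qed
  finally have "(\<Sum>k=1..K. z ^ k) / real (Suc m) \<le> 1 / (t * real (Suc m)) / real (Suc m)"
    by (rule divide_right_mono) simp
  also have "\<dots> = 1 / (real m + 1)\<^sup>2 / t"
    by (simp add: power2_eq_square add.commute mult_ac)
  finally show "(\<Sum>k=1..K. exp (- t * real k) ^ Suc m / real (Suc m)) \<le> 1 / (real m + 1)\<^sup>2 / t"
    unfolding eq .
qed

lemma card_partitions_exp_sqrt: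
  "real (card (partitions n)) \<le> exp ((1 + pi\<^sup>2 / 6) * sqrt (real n))"
proof (cases "n = 0")
  case True
  have "partitions 0 \<subseteq> {[]}" by (auto simp: partitions_def) (metis list.set_intros(1) neq_Nil_conv)
  hence "card (partitions 0) \<le> card {[] :: nat list}" by (intro card_mono) auto
  thus ?thesis using True by simp
next
  case False
  \<comment> \<open>This choice balances the two exponents \<open>t n\<close> and \<open>\<pi>\<^sup>2 / (6 t)\<close> up to a constant.\<close>
  define t where "t = 1 / sqrt (real n)"
  have t: "t > 0" using False by (simp add: t_def)
  have "partitions_le n n = partitions n"
    using member_le_sum_list by (fastforce simp: partitions_le_def partitions_def)
  hence "real (card (partitions n)) * exp (- t * real n) \<le> (\<Prod>k=1..n. 1 / (1 - exp (- t * real k)))"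
    using card_partitions_le_exp_bound[OF t, of n n] by simp
  also have "\<dots> = (\<Prod>k=1..n. exp (- ln (1 - exp (- t * real k))))"
  proof (intro prod.cong refl)
    fix k assume "k \<in> {1..n}"
    hence "1 - exp (- t * real k) > 0" using t by simp
    thus "1 / (1 - exp (- t * real k)) = exp (- ln (1 - exp (- t * real k)))"
      by (simp only: exp_minus[of "ln _"] exp_ln inverse_eq_divide)
  qed
  also have "\<dots> = exp (\<Sum>k=1..n. - ln (1 - exp (- t * real k)))"
    by (simp add: exp_sum)
  also have "\<dots> \<le> exp (pi\<^sup>2 / 6 / t)"
    using log_euler_product_bound[OF t] by simp
  finally have "real (card (partitions n)) \<le> exp (pi\<^sup>2 / 6 / t) * exp (t * real n)"
    by (simp add: exp_minus field_simps)
  also have "\<dots> = exp ((1 + pi\<^sup>2 / 6) * sqrt (real n))"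
    using False by (simp add: t_def real_div_sqrt algebra_simps flip: exp_add)
  finally show ?thesis .
qed


section \<open>Asymptotics\<close>

text \<open>
  Dimensions are at least one, so the finitely many exceptional indices are absorbed by a larger
  constant.
\<close>

lemma plancherel_if_eventually:
  assumes la: "partition_seq la" and C: "C > 0"
    and ev: "\<forall>\<^sub>F n in sequentially. sqrt (fact n) * exp (- C * sqrt (real n)) \<le> real (char_dim (la n))"
  shows "plancherel la"
proof -
  obtain N where N: "\<And>n. n \<ge> N \<Longrightarrow> sqrt (fact n) * exp (- C * sqrt (real n)) \<le> real (char_dim (la n))"
    using ev by (auto simp: eventually_sequentially)
  \<comment> \<open>For \<open>0 < n < N\<close> this gives \<open>sqrt (fact n) \<le> a \<le> exp (a * sqrt n)\<close>; at \<open>n = 0\<close> the claimed lower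
    bound is one.\<close>
  define a where "a = C + (\<Sum>n<N. sqrt (fact n))"
  have S: "(\<Sum>n<N. sqrt (fact n)) \<ge> 0" by (intro sum_nonneg) auto
  have "sqrt (fact n) * exp (- a * sqrt (real n)) \<le> real (char_dim (la n))" for n
  proof (cases "n \<ge> N")
    case True
    have "C * sqrt (real n) \<le> a * sqrt (real n)"
      using S by (intro mult_right_mono) (simp_all add: a_def)
    hence "exp (- a * sqrt (real n)) \<le> exp (- C * sqrt (real n))" by simp
    hence "sqrt (fact n) * exp (- a * sqrt (real n)) \<le> sqrt (fact n) * exp (- C * sqrt (real n))"
      by (rule mult_left_mono) simp
    thus ?thesis using N[OF True] by linarith
  next
    case False
    have "la n \<in> partitions n" using la by (simp add: partition_seq_def)
    hence dim: "real (char_dim (la n)) \<ge> 1" using char_dim_pos by fastforce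
    have "sqrt (fact n) * exp (- a * sqrt (real n)) \<le> 1"
    proof (cases "n = 0")
      case False
      have "sqrt (fact n) \<le> (\<Sum>n<N. sqrt (fact n))"
        using \<open>\<not> N \<le> n\<close> by (intro member_le_sum) auto
      also have "\<dots> \<le> a" using C by (simp add: a_def)
      also have "\<dots> \<le> a * sqrt (real n)"
        using False C S mult_left_mono[of 1 "sqrt (real n)" a] by (simp add: a_def)
      also have "\<dots> \<le> exp (a * sqrt (real n))"
        using exp_ge_add_one_self[of "a * sqrt (real n)"] by linarith
      finally show ?thesis by (simp add: exp_minus field_simps)
    qed simp
    thus ?thesis using dim by linarith
  qed
  moreover have "a > 0" using C S by (simp add: a_def)
  ultimately show ?thesis using la unfolding plancherel_def by blast
qed

lemma plancherel_if_kronecker_asymp: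
  assumes "partition_seq la" "partition_seq mu" "partition_seq nu" "kronecker_asymp la mu nu"
  shows "plancherel la"
proof -
  have p: "la n \<in> partitions n" "mu n \<in> partitions n" "nu n \<in> partitions n" for n
    using assms by (simp_all add: partition_seq_def)
  obtain C where C: "C > 0" and ev: "\<forall>\<^sub>F n in sequentially.
      sqrt (fact n) * exp (- C * sqrt (real n)) \<le> kronecker (la n) (mu n) (nu n)"
    using assms(4) unfolding kronecker_asymp_def eq_exp_O_def
    by (metis (mono_tags, lifting) eventually_mono)
  have "\<forall>\<^sub>F n in sequentially. sqrt (fact n) * exp (- C * sqrt (real n)) \<le> real (char_dim (la n))"
    using ev by eventually_elim (use kronecker_le_char_dim[OF p] order_trans in blast)
  thus ?thesis by (rule plancherel_if_eventually[OF assms(1) C])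
qed

lemma kronecker_asymp_symmetric:
  assumes "partition_seq la" "partition_seq mu" "partition_seq nu" "kronecker_asymp la mu nu"
  shows "kronecker_asymp mu la nu" "kronecker_asymp nu la mu"
proof -
  have p: "la n \<in> partitions n" "mu n \<in> partitions n" "nu n \<in> partitions n" for n
    using assms by (simp_all add: partition_seq_def)
  show "kronecker_asymp mu la nu" "kronecker_asymp nu la mu"
    using assms(4) kronecker_symmetric[OF p] by (simp_all add: kronecker_asymp_def)
qed

text \<open>
  Otherwise every term of the expansion of the product of the two dimensions would be too small for
  their number, as no dimension exceeds \<open>sqrt (fact n)\<close>.
\<close>

lemma ex_large_kronecker:
  assumes la: "la \<in> partitions n" and mu: "mu \<in> partitions n"
    and a: "real (char_dim la) \<ge> sqrt (fact n) * exp (- a * sqrt (real n))"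
    and b: "real (char_dim mu) \<ge> sqrt (fact n) * exp (- b * sqrt (real n))"
  shows "\<exists>nu\<in>partitions n. kronecker la mu nu
           \<ge> sqrt (fact n) * exp (- (a + b + 1 + pi\<^sup>2 / 6) * sqrt (real n))"
proof (rule ccontr)
  let ?s = "sqrt (real n)" and ?q = "sqrt (fact n) :: real"
  define p where "p = exp ((1 + pi\<^sup>2 / 6) * ?s)"
  define x where "x = ?q * exp (- (a + b + 1 + pi\<^sup>2 / 6) * ?s)"
  have xpos: "x > 0" by (simp add: x_def)
  assume "\<not> ?thesis"
  hence less: "kronecker la mu nu < x" if "nu \<in> partitions n" for nu
    using that by (force simp: x_def)
  have "real (char_dim la) * real (char_dim mu) = (\<Sum>nu\<in>partitions n. kronecker la mu nu * real (char_dim nu))"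
    by (rule char_dim_product[OF la mu])
  also have "\<dots> < (\<Sum>nu\<in>partitions n. x * ?q)"
  proof (rule sum_strict_mono)
    fix nu assume nu: "nu \<in> partitions n"
    have "kronecker la mu nu * real (char_dim nu) < x * real (char_dim nu)"
      using less[OF nu] char_dim_pos[OF nu] by simp
    also have "\<dots> \<le> x * ?q"
      using xpos char_dim_le_sqrt_fact[OF nu] by simp
    finally show "kronecker la mu nu * real (char_dim nu) < x * ?q" .
  qed (use la in auto)
  also have "\<dots> = real (card (partitions n)) * (x * ?q)" by simp
  also have "\<dots> \<le> p * (x * ?q)"
    using card_partitions_exp_sqrt[of n] xpos by (intro mult_right_mono) (simp_all add: p_def)
  also have "\<dots> = (?q * exp (- a * ?s)) * (?q * exp (- b * ?s))"
    by (simp add: p_def x_def algebra_simps flip: exp_add)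
  also have "\<dots> \<le> real (char_dim la) * real (char_dim mu)"
    using a b by (intro mult_mono) auto
  finally show False by simp
qed

lemma ex_plancherel_kronecker_asymp:
  assumes la: "plancherel la" and mu: "plancherel mu"
  shows "\<exists>nu. plancherel nu \<and> kronecker_asymp la mu nu"
proof -
  obtain a where a: "a > 0" "\<And>n. real (char_dim (la n)) \<ge> sqrt (fact n) * exp (- a * sqrt (real n))"
    using la unfolding plancherel_def by blast
  obtain b where b: "b > 0" "\<And>n. real (char_dim (mu n)) \<ge> sqrt (fact n) * exp (- b * sqrt (real n))"
    using mu unfolding plancherel_def by blast
  have p: "la n \<in> partitions n" "mu n \<in> partitions n" for n
    using la mu by (simp_all add: plancherel_def partition_seq_def)
  define C where "C = a + b + 1 + pi\<^sup>2 / 6"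
  have C: "C > 0" using a(1) b(1) by (simp add: C_def add_pos_nonneg)
  have "\<forall>n. \<exists>nu. nu \<in> partitions n \<and> kronecker (la n) (mu n) nu \<ge> sqrt (fact n) * exp (- C * sqrt (real n))"
    using ex_large_kronecker[OF p a(2) b(2)] unfolding C_def by blast
  then obtain nu where nu: "\<And>n. nu n \<in> partitions n"
    and lower: "\<And>n. kronecker (la n) (mu n) (nu n) \<ge> sqrt (fact n) * exp (- C * sqrt (real n))"
    by metis
  have dim: "kronecker (la n) (mu n) (nu n) \<le> real (char_dim (nu n))" for n
    using kronecker_le_char_dim[OF nu p] kronecker_symmetric(2)[OF p nu] by simp
  have "plancherel nu"
    unfolding plancherel_def partition_seq_def using nu C order_trans[OF lower dim] by blast
  moreover have "kronecker_asymp la mu nu"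
    unfolding kronecker_asymp_def eq_exp_O_def
  proof (intro exI[of _ C] conjI always_eventually allI C lower)
    fix n
    have "kronecker (la n) (mu n) (nu n) \<le> sqrt (fact n) * 1"
      using dim[of n] char_dim_le_sqrt_fact[OF nu, of n] by simp
    also have "\<dots> \<le> sqrt (fact n) * exp (C * sqrt (real n))"
      using C by (intro mult_left_mono) auto
    finally show "kronecker (la n) (mu n) (nu n) \<le> sqrt (fact n) * exp (C * sqrt (real n))" .
  qed
  ultimately show ?thesis by blast
qed

theorem theorem1p4:
  shows "(\<forall>la mu nu :: nat \<Rightarrow> nat list.
            partition_seq la \<and> partition_seq mu \<and> partition_seq nu \<and> kronecker_asymp la mu nu \<longrightarrow>
            plancherel la \<and> plancherel mu \<and> plancherel nu) \<and>
         (\<forall>la mu :: nat \<Rightarrow> nat list. plancherel la \<and> plancherel mu \<longrightarrow>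
            (\<exists>nu. plancherel nu \<and> kronecker_asymp la mu nu))"
  using plancherel_if_kronecker_asymp kronecker_asymp_symmetric ex_plancherel_kronecker_asymp
  by metis

end
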